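(* Let $p\ge 1$ and $1\le r\le p$ be integers, let $\boldsymbol{Z}$ be a given real $p\times r$ matrix with linearly independent columns, let $0\le a\le 1$, and let $0<\alpha<1$. Consider the multiple logistic regression model with parameter $\boldsymbol{\beta}\in\mathbb{R}^p$ and response probability $p(\mathbf{x})=1/[1+\exp(-\mathbf{x}'\boldsymbol{\beta})]$. For each sample size $n$ let $\hat{\boldsymbol{\beta}}=\hat{\boldsymbol{\beta}}_n$ be the maximum likelihood estimator of $\boldsymbol{\beta}$ and $\boldsymbol{F}=\boldsymbol{F}_n$ the (non-random, symmetric positive definite) $p\times p$ Fisher information matrix, and assume that $\hat{\boldsymbol{\beta}}$ is asymptotically $N_p(\boldsymbol{\beta},\boldsymbol{F}^{-1})$, i.e. $\boldsymbol{F}_n^{1/2}(\hat{\boldsymbol{\beta}}_n-\boldsymbol{\beta})$ converges in distribution to $N_p(\boldsymbol{0},\boldsymbol{I}_p)$ as $n\to\infty$. Let $$\mathscr{X}=\mathscr{X}_n=\{\mathbf{x}\in\mathbb{R}^p:\ \mathbf{x}'\boldsymbol{F}^{-1}\boldsymbol{Z}(\boldsymbol{Z}'\boldsymbol{F}^{-1}\boldsymbol{Z})^{-1}\boldsymbol{Z}'\boldsymbol{F}^{-1}\mathbf{x}\ \ge\ a^2\,\mathbf{x}'\boldsymbol{F}^{-1}\mathbf{x}\}.$$ Let $G$ be a nonnegative random variable whose distribution function is, for $g>0$, $$P(G\le g)=F_{\chi}(g)+\int_g^{g/(1-a^2)}H\big(m(\sqrt{g/w})\big)\,f_{\chi}(w)\,dw,$$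 where $F_{\chi}$ and $f_{\chi}$ are the distribution function and density of the $\chi^2$ distribution with $p$ degrees of freedom, $H$ is the distribution function of the beta$(r/2,(p-r)/2)$ distribution, and $$m(t)=\{at-[(1-a^2)(1-t^2)]^{1/2}\}^2,\qquad 0\le t\le 1.$$ If $c_\alpha>0$ satisfies $P(G\le c_\alpha^2)=1-\alpha$, then the two-sided bands $$\mathbf{x}'\boldsymbol{\beta}\in \mathbf{x}'\hat{\boldsymbol{\beta}}\pm c_\alpha(\mathbf{x}'\boldsymbol{F}^{-1}\mathbf{x})^{1/2}\quad(\mathbf{x}\in\mathscr{X})$$ and $$\{1+\exp[-\mathbf{x}'\hat{\boldsymbol{\beta}}+c_\alpha(\mathbf{x}'\boldsymbol{F}^{-1}\mathbf{x})^{1/2}]\}^{-1}\le p(\mathbf{x})\le\{1+\exp[-\mathbf{x}'\hat{\boldsymbol{\beta}}-c_\alpha(\mathbf{x}'\boldsymbol{F}^{-1}\mathbf{x})^{1/2}]\}^{-1}\quad(\mathbf{x}\in\mathscr{X})$$ are large-sample $100(1-\alpha)\%$ simultaneous confidence bands over $\mathscr{X}$ for $\mathbf{x}'\boldsymbol{\beta}$ and $p(\mathbf{x})$ respectively; that is, for each of the two bands, the probability that it holds simultaneously for all $\mathbf{x}\in\mathscr{X}$ converges to $1-\alpha$ as $n\to\infty$.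
   Context: Model: a binary response $Y\in\{0,1\}$ satisfies $P(Y=1)=p(\mathbf{x})=1/[1+\exp(-\mathbf{x}'\boldsymbol{\beta})]$, where $\mathbf{x}\in\mathbb{R}^p$ is the vector of predictors (in applications with first coordinate equal to $1$) and $\boldsymbol{\beta}\in\mathbb{R}^p$ is the unknown parameter. A prime denotes transpose, and $\boldsymbol{F}^{1/2}$ denotes the symmetric positive definite square root of $\boldsymbol{F}$. The notation $A\in B\pm C$ means $B-C\le A\le B+C$. The only property of the maximum likelihood estimator that is assumed is its asymptotic normality as given in the claim. Conventions for boundary cases: if $a=1$, the upper limit $g/(1-a^2)$ of the integral is $+\infty$; if $r=p$, the beta$(p/2,0)$ distribution is understood as the point mass at $1$, so $H(t)=0$ for $t<1$ and $H(t)=1$ for $t\ge 1$. *)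

theory Defs
  imports "HOL-Probability.Probability"
begin

definition sym_pos_def :: "real ^ 'n ^ 'n \<Rightarrow> bool" where
  "sym_pos_def A \<longleftrightarrow> transpose A = A \<and> (\<forall>v. v \<noteq> 0 \<longrightarrow> v \<bullet> (A *v v) > 0)"

definition matrix_sqrt :: "real ^ 'n ^ 'n \<Rightarrow> real ^ 'n ^ 'n" where
  "matrix_sqrt A = (THE S. sym_pos_def S \<and> S ** S = A)"

text \<open>The library has weak convergence only for measures on the real line; this is the usual
  definition by bounded continuous test functions.\<close>

definition converges_in_distribution ::
    "(nat \<Rightarrow> 'b::topological_space measure) \<Rightarrow> 'b measure \<Rightarrow> bool" where
  "converges_in_distribution \<mu> \<nu> \<longleftrightarrow>
     (\<forall>f :: 'b \<Rightarrow> real. continuous_on UNIV f \<longrightarrow> bounded (range f) \<longrightarrow>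
        (\<lambda>n. integral\<^sup>L (\<mu> n) f) \<longlonglongrightarrow> integral\<^sup>L \<nu> f)"

definition std_normal_vec :: "(real ^ 'p) measure" where
  "std_normal_vec = density lborel
     (\<lambda>v. ennreal ((2 * pi) powr (- real CARD('p) / 2) * exp (- (norm v)\<^sup>2 / 2)))"

definition chi_square_density :: "nat \<Rightarrow> real \<Rightarrow> real" where
  "chi_square_density k w =
     (if w > 0
      then w powr (real k / 2 - 1) * exp (- w / 2) / (2 powr (real k / 2) * Gamma (real k / 2))
      else 0)"

definition chi_square_distribution :: "nat \<Rightarrow> real measure" where
  "chi_square_distribution k = density lborel (\<lambda>w. ennreal (chi_square_density k w))"

text \<open>For \<open>b = 0\<close> the beta distribution is understood as the point mass at 1.\<close>

definition beta_distribution :: "real \<Rightarrow> real \<Rightarrow> real measure" where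
  "beta_distribution a b =
     (if b = 0 then return borel 1
      else density lborel (\<lambda>t. ennreal
        (if 0 < t \<and> t < 1 then t powr (a - 1) * (1 - t) powr (b - 1) / Beta a b else 0)))"

definition resp_prob :: "real ^ 'p \<Rightarrow> real ^ 'p \<Rightarrow> real" where
  "resp_prob \<beta> x = 1 / (1 + exp (- (x \<bullet> \<beta>)))"

text \<open>A sample of size \<open>n\<close> with predictor vectors \<open>d 0, \<dots>, d (n - 1)\<close> (a fixed design) and
  independent binary responses \<open>Y 0, \<dots>, Y (n - 1)\<close>.\<close>

definition logistic_sample ::
    "'w measure \<Rightarrow> real ^ 'p \<Rightarrow> nat \<Rightarrow> (nat \<Rightarrow> real ^ 'p) \<Rightarrow> (nat \<Rightarrow> 'w \<Rightarrow> nat) \<Rightarrow> bool" where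
  "logistic_sample M \<beta> n d Y \<longleftrightarrow>
     prob_space M \<and>
     prob_space.indep_vars M (\<lambda>_. count_space UNIV) Y {..<n} \<and>
     (\<forall>i<n. (\<forall>\<omega>\<in>space M. Y i \<omega> \<in> {0, 1}) \<and>
            measure M {\<omega> \<in> space M. Y i \<omega> = 1} = resp_prob \<beta> (d i))"

definition likelihood :: "nat \<Rightarrow> (nat \<Rightarrow> real ^ 'p) \<Rightarrow> (nat \<Rightarrow> nat) \<Rightarrow> real ^ 'p \<Rightarrow> real" where
  "likelihood n d y b = (\<Prod>i<n. resp_prob b (d i) ^ y i * (1 - resp_prob b (d i)) ^ (1 - y i))"

definition is_mle :: "nat \<Rightarrow> (nat \<Rightarrow> real ^ 'p) \<Rightarrow> (nat \<Rightarrow> nat) \<Rightarrow> real ^ 'p \<Rightarrow> bool" where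
  "is_mle n d y b \<longleftrightarrow> (\<forall>b'. likelihood n d y b' \<le> likelihood n d y b)"

text \<open>Unless all predictor vectors are zero, the likelihood has no maximizer at some response
  vectors (the separated ones), and these have positive probability.  There the value of the
  estimator is left unspecified; demanding a maximizer at every outcome would be unsatisfiable.\<close>

definition ml_estimator ::
    "'w measure \<Rightarrow> nat \<Rightarrow> (nat \<Rightarrow> real ^ 'p) \<Rightarrow> (nat \<Rightarrow> 'w \<Rightarrow> nat) \<Rightarrow> ('w \<Rightarrow> real ^ 'p) \<Rightarrow> bool" where
  "ml_estimator M n d Y bh \<longleftrightarrow>
     bh \<in> borel_measurable M \<and>
     (\<forall>\<omega>\<in>space M. (\<exists>b. is_mle n d (\<lambda>i. Y i \<omega>) b) \<longrightarrow> is_mle n d (\<lambda>i. Y i \<omega>) (bh \<omega>))"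

definition score :: "nat \<Rightarrow> (nat \<Rightarrow> real ^ 'p) \<Rightarrow> (nat \<Rightarrow> nat) \<Rightarrow> real ^ 'p \<Rightarrow> real ^ 'p" where
  "score n d y b =
     (\<chi> j. frechet_derivative (\<lambda>b'. ln (likelihood n d y b')) (at b) (axis j 1))"

definition fisher_information ::
    "'w measure \<Rightarrow> real ^ 'p \<Rightarrow> nat \<Rightarrow> (nat \<Rightarrow> real ^ 'p) \<Rightarrow> (nat \<Rightarrow> 'w \<Rightarrow> nat) \<Rightarrow> real ^ 'p ^ 'p" where
  "fisher_information M \<beta> n d Y =
     (\<chi> j k. \<integral>\<omega>. score n d (\<lambda>i. Y i \<omega>) \<beta> $ j * score n d (\<lambda>i. Y i \<omega>) \<beta> $ k \<partial>M)"

lemma resp_prob_bounds: "0 < resp_prob b x" "resp_prob b x < 1"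
  by (auto simp: resp_prob_def add_pos_pos intro!: divide_pos_pos)

lemma score_eq:
  assumes "\<forall>i<n. y i \<in> {0, 1}"
  shows "score n d y b = (\<Sum>i<n. (real (y i) - resp_prob b (d i)) *\<^sub>R d i)"
proof -
  define t where "t i b' = - (1 - real (y i)) * (d i \<bullet> b') - ln (1 + exp (- (d i \<bullet> b')))" for i b'
  have pos: "1 + exp z > 0" for z :: real by (simp add: add_pos_pos)
  have p: "ln (resp_prob b' (d i)) = - ln (1 + exp (- (d i \<bullet> b')))" for i b'
    using pos by (simp add: resp_prob_def ln_div)
  have q: "ln (1 - resp_prob b' (d i)) = - (d i \<bullet> b') - ln (1 + exp (- (d i \<bullet> b')))" for i b'
  proof -
    have "1 - resp_prob b' (d i) = exp (- (d i \<bullet> b')) / (1 + exp (- (d i \<bullet> b')))"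
      using pos[of "- (d i \<bullet> b')"] by (simp add: resp_prob_def field_simps)
    then show ?thesis using pos[of "- (d i \<bullet> b')"] by (simp add: ln_div)
  qed
  have summand: "ln (resp_prob b' (d i) ^ y i * (1 - resp_prob b' (d i)) ^ (1 - y i)) = t i b'"
    if "i < n" for i b'
  proof -
    have "y i = 0 \<or> y i = 1" using assms that by auto
    then show ?thesis using p q by (auto simp: t_def)
  qed
  have ln_lik: "ln (likelihood n d y b') = (\<Sum>i<n. t i b')" for b'
    unfolding likelihood_def
  proof (subst ln_prod)
    show "resp_prob b' (d i) ^ y i * (1 - resp_prob b' (d i)) ^ (1 - y i) \<noteq> 0" for i
      using resp_prob_bounds[of b' "d i"] by simp
  qed (auto simp del: One_nat_def intro!: sum.cong summand)
  have "((\<lambda>b'. t i b') has_derivative (\<lambda>v. (real (y i) - resp_prob b (d i)) * (d i \<bullet> v))) (at b)" for i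
  proof -
    have quot: "exp (- (d i \<bullet> b)) / (1 + exp (- (d i \<bullet> b))) = 1 - resp_prob b (d i)"
      using pos[of "- (d i \<bullet> b)"] by (simp add: resp_prob_def field_simps)
    have "- (1 - real (y i)) * z - exp (- (d i \<bullet> b)) * (- z) / (1 + exp (- (d i \<bullet> b))) =
        (real (y i) - resp_prob b (d i)) * z" for z
    proof -
      have "exp (- (d i \<bullet> b)) * (- z) / (1 + exp (- (d i \<bullet> b))) = (1 - resp_prob b (d i)) * (- z)"
        by (simp flip: quot)
      then show ?thesis by (simp only:) (simp add: algebra_simps)
    qed
    moreover have "((\<lambda>b'. t i b') has_derivative (\<lambda>v. - (1 - real (y i)) * (d i \<bullet> v) -
        exp (- (d i \<bullet> b)) * (- (d i \<bullet> v)) / (1 + exp (- (d i \<bullet> b))))) (at b)"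
      unfolding t_def using pos[of "- (d i \<bullet> b)"]
      by (auto intro!: derivative_eq_intros simp: divide_inverse)
    ultimately show ?thesis by simp
  qed
  then have "((\<lambda>b'. \<Sum>i<n. t i b') has_derivative
      (\<lambda>v. \<Sum>i<n. (real (y i) - resp_prob b (d i)) * (d i \<bullet> v))) (at b)"
    by (intro has_derivative_sum) auto
  from frechet_derivative_at[OF this]
  have "frechet_derivative (\<lambda>b'. ln (likelihood n d y b')) (at b) =
      (\<lambda>v. \<Sum>i<n. (real (y i) - resp_prob b (d i)) * (d i \<bullet> v))"
    unfolding ln_lik by simp
  then show ?thesis
    unfolding score_def by (simp add: vec_eq_iff inner_axis)
qed

text \<open>The matrix \<open>X'VX\<close> familiar from logistic regression.\<close>

lemma fisher_information_eq:
  assumes "logistic_sample M \<beta> n d Y"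
  shows "fisher_information M \<beta> n d Y =
    (\<chi> j k. \<Sum>i<n. resp_prob \<beta> (d i) * (1 - resp_prob \<beta> (d i)) * d i $ j * d i $ k)"
proof -
  interpret prob_space M using assms by (simp add: logistic_sample_def)
  have ind: "indep_vars (\<lambda>_. count_space UNIV) Y {..<n}"
    and Y01: "\<And>i \<omega>. i < n \<Longrightarrow> \<omega> \<in> space M \<Longrightarrow> Y i \<omega> = 0 \<or> Y i \<omega> = 1"
    and PY: "\<And>i. i < n \<Longrightarrow> measure M {\<omega> \<in> space M. Y i \<omega> = 1} = resp_prob \<beta> (d i)"
    using assms by (auto simp: logistic_sample_def)
  have meas [measurable]: "i < n \<Longrightarrow> Y i \<in> measurable M (count_space UNIV)" for i
    using ind by (auto simp: indep_vars_def)
  define P where "P i = resp_prob \<beta> (d i)" for i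
  define e where "e i \<omega> = real (Y i \<omega>) - P i" for i \<omega>
  have e_meas [measurable]: "i < n \<Longrightarrow> e i \<in> borel_measurable M" for i
    unfolding e_def by measurable
  have EY: "expectation (\<lambda>\<omega>. real (Y i \<omega>)) = P i" and iY: "integrable M (\<lambda>\<omega>. real (Y i \<omega>))"
    if "i < n" for i
  proof -
    have "expectation (\<lambda>\<omega>. real (Y i \<omega>)) =
        expectation (indicator {\<omega> \<in> space M. Y i \<omega> = 1})"
      using Y01[OF that] by (intro Bochner_Integration.integral_cong) (auto simp: indicator_def)
    also have "\<dots> = P i" using PY[OF that] that by (simp add: P_def)
    finally show "expectation (\<lambda>\<omega>. real (Y i \<omega>)) = P i" .
    show "integrable M (\<lambda>\<omega>. real (Y i \<omega>))"
      using that Y01[OF that]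
      by (intro integrable_const_bound[where B = 1]) (force intro!: AE_I2, measurable)
  qed
  have ie: "integrable M (e i)" and Ee: "expectation (e i) = 0" if "i < n" for i
    using EY[OF that] iY[OF that] unfolding e_def[abs_def] by (simp_all add: prob_space)
  have ind_e: "indep_vars (\<lambda>_. borel) e {..<n}"
    unfolding e_def by (rule indep_vars_compose2[OF ind]) auto
  have off: "integrable M (\<lambda>\<omega>. e i \<omega> * e k \<omega>)" "expectation (\<lambda>\<omega>. e i \<omega> * e k \<omega>) = 0"
    if "i < n" "k < n" "i \<noteq> k" for i k
  proof -
    have "indep_vars (\<lambda>_. borel) e {i, k}"
      using that by (intro indep_vars_subset[OF ind_e]) auto
    then have "integrable M (\<lambda>\<omega>. \<Prod>l\<in>{i, k}. e l \<omega>)"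
      "expectation (\<lambda>\<omega>. \<Prod>l\<in>{i, k}. e l \<omega>) = (\<Prod>l\<in>{i, k}. expectation (e l))"
      using that ie by (auto intro!: indep_vars_integrable indep_vars_lebesgue_integral simp del: prod.insert)
    then show "integrable M (\<lambda>\<omega>. e i \<omega> * e k \<omega>)" "expectation (\<lambda>\<omega>. e i \<omega> * e k \<omega>) = 0"
      using that Ee by auto
  qed
  have diag: "integrable M (\<lambda>\<omega>. e i \<omega> * e i \<omega>)"
    "expectation (\<lambda>\<omega>. e i \<omega> * e i \<omega>) = P i * (1 - P i)" if "i < n" for i
  proof -
    have sq: "e i \<omega> * e i \<omega> = (1 - 2 * P i) * real (Y i \<omega>) + (P i)\<^sup>2" if "\<omega> \<in> space M" for \<omega>
      using Y01[OF \<open>i < n\<close> that] by (auto simp: e_def power2_eq_square algebra_simps)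
    show "integrable M (\<lambda>\<omega>. e i \<omega> * e i \<omega>)"
      using iY[OF that] by (subst Bochner_Integration.integrable_cong[OF refl sq]) auto
    have "expectation (\<lambda>\<omega>. e i \<omega> * e i \<omega>) = (1 - 2 * P i) * P i + (P i)\<^sup>2"
      using iY[OF that] EY[OF that]
      by (subst Bochner_Integration.integral_cong[OF refl sq]) (auto simp: prob_space)
    then show "expectation (\<lambda>\<omega>. e i \<omega> * e i \<omega>) = P i * (1 - P i)"
      by (simp add: power2_eq_square algebra_simps)
  qed
  have int: "integrable M (\<lambda>\<omega>. e i \<omega> * e k \<omega>)" if "i < n" "k < n" for i k
    using off(1) diag(1) that by (cases "i = k") auto
  have E: "expectation (\<lambda>\<omega>. e i \<omega> * e k \<omega>) = (if k = i then P i * (1 - P i) else 0)"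
    if "i < n" "k < n" for i k
    using off(2) diag(2) that by auto
  have sc: "score n d (\<lambda>i. Y i \<omega>) \<beta> = (\<Sum>i<n. e i \<omega> *\<^sub>R d i)" if "\<omega> \<in> space M" for \<omega>
    using Y01 that by (subst score_eq) (auto simp: e_def P_def)
  have "fisher_information M \<beta> n d Y $ j $ l =
      (\<Sum>i<n. P i * (1 - P i) * d i $ j * d i $ l)" for j l
  proof -
    have "fisher_information M \<beta> n d Y $ j $ l =
        expectation (\<lambda>\<omega>. \<Sum>i<n. \<Sum>k<n. (d i $ j * d k $ l) * (e i \<omega> * e k \<omega>))"
      unfolding fisher_information_def
      by (simp, intro Bochner_Integration.integral_cong)
         (auto simp: sc sum_product mult_ac)
    also have "\<dots> = (\<Sum>i<n. \<Sum>k<n. (d i $ j * d k $ l) * expectation (\<lambda>\<omega>. e i \<omega> * e k \<omega>))"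
      using int by (subst Bochner_Integration.integral_sum, force intro!: Bochner_Integration.integrable_sum,
          intro sum.cong refl, subst Bochner_Integration.integral_sum, force, simp)
    also have "\<dots> = (\<Sum>i<n. \<Sum>k<n. if k = i then (d i $ j * d k $ l) * (P i * (1 - P i)) else 0)"
      using E by (intro sum.cong) auto
    also have "\<dots> = (\<Sum>i<n. P i * (1 - P i) * d i $ j * d i $ l)"
      by (intro sum.cong) (auto simp: mult_ac)
    finally show ?thesis .
  qed
  then show ?thesis by (simp add: vec_eq_iff P_def)
qed

definition predictor_region :: "real ^ 'p ^ 'p \<Rightarrow> real ^ 'r ^ 'p \<Rightarrow> real \<Rightarrow> (real ^ 'p) set" where
  "predictor_region F Z a =
     {x. x \<bullet> ((matrix_inv F ** Z ** matrix_inv (transpose Z ** matrix_inv F ** Z) **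
               transpose Z ** matrix_inv F) *v x)
         \<ge> a\<^sup>2 * (x \<bullet> (matrix_inv F *v x))}"

definition m_fun :: "real \<Rightarrow> real \<Rightarrow> real" where
  "m_fun a t = (a * t - sqrt ((1 - a\<^sup>2) * (1 - t\<^sup>2)))\<^sup>2"

definition G_cdf :: "nat \<Rightarrow> nat \<Rightarrow> real \<Rightarrow> real \<Rightarrow> real" where
  "G_cdf p r a g =
     cdf (chi_square_distribution p) g +
     (LBINT w = ereal g .. (if a = 1 then \<infinity> else ereal (g / (1 - a\<^sup>2))).
        cdf (beta_distribution (real r / 2) (real (p - r) / 2)) (m_fun a (sqrt (g / w))) *
        chi_square_density p w)"

end

theory Submission
  imports Defs
begin

text \<open>Put \<open>y = F\<^sup>-\<^sup>1\<^sup>/\<^sup>2 x\<close> and \<open>u = F\<^sup>1\<^sup>/\<^sup>2 (bh - \<beta>)\<close>, and let \<open>P\<close> be the orthogonal projection onto the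
  column space of \<open>F\<^sup>-\<^sup>1\<^sup>/\<^sup>2 Z\<close>, which has rank \<open>r\<close>. The band holds on the whole region iff
  \<open>\<bar>y \<bullet> u\<bar> \<le> c \<cdot> norm y\<close> for all \<open>y\<close> with \<open>norm (P y) \<ge> a \<cdot> norm y\<close>, i.e. iff \<open>h\<^sub>P(u) \<le> c\<close>, where \<open>h\<^sub>P\<close> is an
  explicit function of \<open>norm (P u)\<close> and \<open>norm (u - P u)\<close>, positively homogeneous in \<open>u\<close>.

  Since \<open>P\<close> varies with the sample size, convergence in distribution of \<open>u\<close> alone is not enough.
  But the projections of rank \<open>r\<close> form a compact set, \<open>h\<^sub>P(u)\<close> is Lipschitz in \<open>P\<close> with constant
  proportional to \<open>norm u\<close>, and by rotation invariance the law of \<open>h\<^sub>P(N)\<close>, \<open>N\<close> standard normal, does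
  not depend on \<open>P\<close>; so \<open>h\<^sub>P(u)\<close> converges in distribution to \<open>h\<^sub>P(N)\<close>, which has no atom at \<open>c\<close>.

  Finally \<open>W = norm N ^ 2\<close> is chi-square with \<open>p\<close> degrees of freedom and independent of
  \<open>B = norm (P N) ^ 2 / W\<close>, which is beta distributed. Conditioning on \<open>W = w\<close>, the event \<open>h\<^sub>P(N) \<le> c\<close>
  is certain for \<open>w \<le> c\<^sup>2\<close>, impossible for \<open>w > c\<^sup>2 / (1 - a\<^sup>2)\<close>, and equivalent to \<open>B \<le> m (c / sqrt w)\<close> in
  between.\<close>

subsection \<open>Chi-square and beta distributions\<close>

text \<open>The derivative in \<open>t\<close> of \<open>unit_ball_vol k * sqrt t ^ k\<close>, the
  volume of the k-dimensional ball of squared radius \<open>t\<close>. It belongs to an infinite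
  measure, not to a probability law.\<close>

definition sqsum_density :: "nat \<Rightarrow> real \<Rightarrow> real" where
  "sqsum_density k t = (if t > 0 then unit_ball_vol k * (k / 2) * t powr (k / 2 - 1) else 0)"

lemma sqsum_density_measurable [measurable]: "sqsum_density k \<in> borel_measurable borel"
  unfolding sqsum_density_def by measurable

lemma chi_square_density_measurable [measurable]: "chi_square_density k \<in> borel_measurable borel"
  unfolding chi_square_density_def by measurable

lemma chi_square_density_nonneg: "0 < k \<Longrightarrow> 0 \<le> chi_square_density k t"
  by (auto simp: chi_square_density_def intro!: divide_nonneg_nonneg mult_nonneg_nonneg Gamma_real_nonneg)

lemma nn_integral_sqsum_density:
  assumes "k > 0" "g > 0"
  shows "(\<integral>\<^sup>+t. ennreal (sqsum_density k t) * indicator {..g} t \<partial>lborel) =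
    ennreal (unit_ball_vol k * sqrt g ^ k)"
proof -
  have "((\<lambda>t. t powr (k / 2 - 1)) has_integral (g powr (k / 2 - 1 + 1) / (k / 2 - 1 + 1))) {0..g}"
    using assms by (intro has_integral_powr_from_0) auto
  from has_integral_mult_right[OF this, of "unit_ball_vol k * (k / 2)"]
  have "((\<lambda>t. unit_ball_vol k * (k / 2) * t powr (k / 2 - 1)) has_integral
      unit_ball_vol k * g powr (k / 2)) {0..g}"
    using assms by simp
  from nn_integral_has_integral_lebesgue[OF _ this]
  have "(\<integral>\<^sup>+t. ennreal (indicator {0..g} t * (unit_ball_vol k * (k / 2) * t powr (k / 2 - 1))) \<partial>lborel) =
      ennreal (unit_ball_vol k * g powr (k / 2))"
    by (simp add: mult_ac)
  also have "g powr (k / 2) = sqrt g ^ k"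
    using assms by (simp add: powr_half_sqrt[symmetric] powr_realpow[symmetric] powr_powr)
  also have "(\<integral>\<^sup>+t. ennreal (indicator {0..g} t * (unit_ball_vol k * (k / 2) * t powr (k / 2 - 1))) \<partial>lborel) =
      (\<integral>\<^sup>+t. ennreal (sqsum_density k t) * indicator {..g} t \<partial>lborel)"
    by (intro nn_integral_cong) (auto simp: sqsum_density_def indicator_def)
  finally show ?thesis .
qed

text \<open>The preimage of \<open>{..g}\<close> is a ball of radius \<open>sqrt g\<close>, whose
  volume is known, and half-lines generate the Borel sets. An arbitrary finite index set
  \<open>A\<close> allows the use on blocks of coordinates.\<close>

lemma distr_sqsum:
  fixes A :: "'i set"
  assumes A: "finite A" "A \<noteq> {}"
  shows "distr (PiM A (\<lambda>_. lborel)) borel (\<lambda>x. \<Sum>i\<in>A. (x i)\<^sup>2) =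
    density lborel (\<lambda>t. ennreal (sqsum_density (card A) t))" (is "?L = ?R")
proof -
  have k: "card A > 0" using A by (simp add: card_gt_0_iff)
  let ?P = "PiM A (\<lambda>_. lborel :: real measure)"
  have cb: "emeasure ?L {..g} = ennreal (unit_ball_vol (card A) * sqrt g ^ card A)" if "g > 0" for g
  proof -
    have "emeasure ?L {..g} = emeasure ?P ({f. sqrt (\<Sum>i\<in>A. (f i)\<^sup>2) \<le> sqrt g} \<inter> space ?P)"
      by (subst emeasure_distr) (auto intro!: arg_cong[of _ _ "emeasure ?P"])
    then show ?thesis using emeasure_cball_aux[OF A(1), of "sqrt g"] that by simp
  qed
  have rb: "emeasure ?R {..g} = ennreal (unit_ball_vol (card A) * sqrt g ^ card A)" if "g > 0" for g
    using nn_integral_sqsum_density[OF k that] by (simp add: emeasure_density)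
  \<comment> \<open>The volume formula covers positive radii only. For \<open>g \<le> 0\<close> the
    preimage is enclosed in balls of radius tending to 0, whose volumes vanish in the limit because
    \<open>card A > 0\<close>.\<close>
  have zero: "emeasure ?L {..g} = 0" if "g \<le> 0" for g
  proof -
    have "emeasure ?L {..g} \<le> ennreal (unit_ball_vol (card A) * (1 / Suc n) ^ card A)" for n
    proof -
      have "emeasure ?L {..g} \<le> emeasure ?L {..(1 / Suc n)\<^sup>2}"
        using that by (intro emeasure_mono) (auto intro: order_trans)
      also have "\<dots> = ennreal (unit_ball_vol (card A) * (1 / Suc n) ^ card A)"
        by (subst cb) (auto simp: real_sqrt_divide)
      finally show ?thesis .
    qed
    moreover have "(\<lambda>n. unit_ball_vol (card A) * (1 / Suc n) ^ card A) \<longlonglongrightarrow> unit_ball_vol (card A) * 0 ^ card A"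
      by (intro tendsto_intros LIMSEQ_inverse_real_of_nat[unfolded inverse_eq_divide])
    then have "(\<lambda>n. ennreal (unit_ball_vol (card A) * (1 / Suc n) ^ card A)) \<longlonglongrightarrow> ennreal 0"
      using k by (intro tendsto_ennrealI) (simp add: zero_power)
    ultimately have "emeasure ?L {..g} \<le> ennreal 0" by (intro LIMSEQ_le_const) auto
    then show ?thesis by simp
  qed
  have rzero: "emeasure ?R {..g} = 0" if "g \<le> 0" for g
    using that by (auto simp: emeasure_density sqsum_density_def indicator_def nn_integral_0_iff_AE)
  have eq: "emeasure ?L {..g} = emeasure ?R {..g}" for g
    using cb[of g] rb[of g] zero[of g] rzero[of g] by (cases "g > 0") auto
  show ?thesis
  \<comment> \<open>\<open>Suc n\<close> keeps every half-line of the exhausting sequence in the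
    range \<open>g > 0\<close>, where the volume formula shows its measure to be finite.\<close>
  proof (rule measure_eqI_generator_eq[where E = "range atMost" and \<Omega> = UNIV and A = "\<lambda>n::nat. {..real (Suc n)}"])
    show "Int_stable (range (atMost :: real \<Rightarrow> _))"
      by (auto simp: Int_stable_def)
    show "(\<Union>i. {..real (Suc i)}) = UNIV"
      by (auto, metis of_nat_Suc real_arch_simple le_add_same_cancel2 order_trans zero_le_one)
    show "sets ?L = sigma_sets UNIV (range atMost)"
      by (simp add: borel_eq_atMost)
    show "sets ?R = sigma_sets UNIV (range atMost)"
      by (simp add: borel_eq_atMost)
    show "emeasure ?L {..real (Suc i)} \<noteq> \<infinity>" for i
      by (subst cb) auto
  qed (auto simp: eq)
qed

text \<open>The Gaussian weight is itself a function of the sum of squares, so it is absorbed into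
  the integrand before \<open>distr_sqsum\<close> is applied; weight times
  \<open>sqsum_density\<close> is the chi-square density.\<close>

lemma nn_integral_sqsum_gauss:
  assumes A: "finite A" "A \<noteq> {}" and [measurable]: "f \<in> borel_measurable borel"
  shows "(\<integral>\<^sup>+x. f (\<Sum>i\<in>A. (x i)\<^sup>2) *
        ennreal ((2 * pi) powr (- real (card A) / 2) * exp (- (\<Sum>i\<in>A. (x i)\<^sup>2) / 2)) \<partial>PiM A (\<lambda>_. lborel)) =
    (\<integral>\<^sup>+t. f t * ennreal (chi_square_density (card A) t) \<partial>lborel)"
proof -
  define k where "k = real (card A)"
  have k: "k > 0" using A by (simp add: card_gt_0_iff k_def)
  define h where "h t = f t * ennreal ((2 * pi) powr (- k / 2) * exp (- t / 2))" for t
  have [measurable]: "h \<in> borel_measurable borel" unfolding h_def by measurable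
  have const: "(2 * pi) powr (- k / 2) * (unit_ball_vol k * (k / 2)) = 1 / (2 powr (k / 2) * Gamma (k / 2))"
  proof -
    have "Gamma (k / 2 + 1) = k / 2 * Gamma (k / 2)"
      using k by (intro Gamma_plus1) (auto dest: nonpos_Ints_nonpos)
    then have "unit_ball_vol k * (k / 2) = pi powr (k / 2) / Gamma (k / 2)"
      using k by (simp add: unit_ball_vol_def)
    moreover have "(2 * pi) powr (- k / 2) = 1 / (2 powr (k / 2) * pi powr (k / 2))"
      by (simp add: powr_minus powr_mult field_simps)
    ultimately show ?thesis by simp
  qed
  have "(\<integral>\<^sup>+x. h (\<Sum>i\<in>A. (x i)\<^sup>2) \<partial>PiM A (\<lambda>_. lborel)) =
      (\<integral>\<^sup>+t. h t \<partial>distr (PiM A (\<lambda>_. lborel)) borel (\<lambda>x. \<Sum>i\<in>A. (x i)\<^sup>2))"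
    by (subst nn_integral_distr) auto
  also have "\<dots> = (\<integral>\<^sup>+t. ennreal (sqsum_density (card A) t) * h t \<partial>lborel)"
    unfolding distr_sqsum[OF A] by (subst nn_integral_density) auto
  also have "\<dots> = (\<integral>\<^sup>+t. f t * ennreal (chi_square_density (card A) t) \<partial>lborel)"
  proof (intro nn_integral_cong)
    fix t :: real
    have "sqsum_density (card A) t * ((2 * pi) powr (- k / 2) * exp (- t / 2)) = chi_square_density (card A) t"
    proof (cases "t > 0")
      case True
      then have "sqsum_density (card A) t * ((2 * pi) powr (- k / 2) * exp (- t / 2)) =
          ((2 * pi) powr (- k / 2) * (unit_ball_vol k * (k / 2))) * (t powr (k / 2 - 1) * exp (- t / 2))"
        by (simp add: sqsum_density_def k_def)
      then show ?thesis
        unfolding const using True by (simp add: chi_square_density_def k_def)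
    qed (simp add: sqsum_density_def chi_square_density_def)
    then show "ennreal (sqsum_density (card A) t) * h t = f t * ennreal (chi_square_density (card A) t)"
      unfolding h_def
      by (metis (no_types) ennreal_mult'' exp_ge_zero mult.left_commute powr_ge_zero mult_nonneg_nonneg)
  qed
  finally show ?thesis unfolding h_def k_def by simp
qed

section \<open>Sum and ratio of two chi-square variables\<close>

definition beta_density :: "real \<Rightarrow> real \<Rightarrow> real \<Rightarrow> real" where
  "beta_density a b t = (if 0 < t \<and> t < 1 then t powr (a - 1) * (1 - t) powr (b - 1) / Beta a b else 0)"

lemma beta_density_measurable [measurable]: "beta_density a b \<in> borel_measurable borel"
  unfolding beta_density_def by measurable

lemma Beta_real_pos: "0 < a \<Longrightarrow> 0 < b \<Longrightarrow> 0 < Beta a (b::real)"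
  by (simp add: Beta_def)

lemma nn_integral_beta_density:
  assumes "0 < a" "0 < b"
  shows "(\<integral>\<^sup>+t. ennreal (beta_density a b t) \<partial>lborel) = 1"
proof -
  have "((\<lambda>t. t powr (a - 1) * (1 - t) powr (b - 1)) has_integral Beta a b) {0..1}"
    using assms by (intro has_integral_Beta_real)
  from has_integral_mult_left[OF this, of "1 / Beta a b"]
  have "((\<lambda>t. t powr (a - 1) * (1 - t) powr (b - 1) * (1 / Beta a b)) has_integral 1) {0..1}"
    using Beta_real_pos[OF assms] by simp
  from nn_integral_has_integral_lebesgue[OF _ this]
  have "(\<integral>\<^sup>+t. ennreal (indicator {0..1} t * (t powr (a - 1) * (1 - t) powr (b - 1) * (1 / Beta a b))) \<partial>lborel) = 1"
    using Beta_real_pos[OF assms] by simp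
  also have "(\<integral>\<^sup>+t. ennreal (indicator {0..1} t * (t powr (a - 1) * (1 - t) powr (b - 1) * (1 / Beta a b))) \<partial>lborel) =
      (\<integral>\<^sup>+t. ennreal (beta_density a b t) \<partial>lborel)"
    by (rule nn_integral_cong) (auto simp: beta_density_def indicator_def)
  finally show ?thesis .
qed

text \<open>The pointwise form of the independence of \<open>w = x + y\<close> and
  \<open>b = x / w\<close>; the leading \<open>w\<close> is the Jacobian of
  \<open>(w, b) \<mapsto> (w * b, w * (1 - b))\<close>.\<close>

lemma chi_square_beta_factorization:
  assumes "0 < m" "0 < n" "0 < w"
  shows "w * (chi_square_density m (w * b) * chi_square_density n (w * (1 - b))) =
    chi_square_density (m + n) w * beta_density (m / 2) (n / 2) b"
proof (cases "0 < b \<and> b < 1")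
  case True
  let ?m = "m / 2 :: real" and ?n = "n / 2 :: real"
  have G: "Gamma ?m > 0" "Gamma ?n > 0" "Gamma (?m + ?n) > 0"
    using assms by (auto intro!: Gamma_real_pos)
  have e: "(real m + real n) / 2 = ?m + ?n" by (simp add: add_divide_distrib)
  have wpow: "w * (w powr (?m - 1) * w powr (?n - 1)) = w powr (?m + ?n - 1)"
    using assms by (simp add: powr_add[symmetric] powr_mult_base)
  have epow: "exp (- (w * b) / 2) * exp (- (w * (1 - b)) / 2) = exp (- w / 2)"
    by (simp add: exp_add[symmetric] algebra_simps flip: add_divide_distrib)
  have cm: "chi_square_density m (w * b) =
      w powr (?m - 1) * b powr (?m - 1) * exp (- (w * b) / 2) / (2 powr ?m * Gamma ?m)"
    using True assms by (simp add: chi_square_density_def powr_mult)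
  have cn: "chi_square_density n (w * (1 - b)) =
      w powr (?n - 1) * (1 - b) powr (?n - 1) * exp (- (w * (1 - b)) / 2) / (2 powr ?n * Gamma ?n)"
    using True assms by (simp add: chi_square_density_def powr_mult)
  have "w * (chi_square_density m (w * b) * chi_square_density n (w * (1 - b))) =
      (w * (w powr (?m - 1) * w powr (?n - 1))) * (exp (- (w * b) / 2) * exp (- (w * (1 - b)) / 2)) *
        (b powr (?m - 1) * (1 - b) powr (?n - 1)) / (2 powr ?m * 2 powr ?n * (Gamma ?m * Gamma ?n))"
    unfolding cm cn by (simp add: mult_ac)
  also have "\<dots> = w powr (?m + ?n - 1) * exp (- w / 2) * (b powr (?m - 1) * (1 - b) powr (?n - 1)) /
        (2 powr (?m + ?n) * (Gamma ?m * Gamma ?n))"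
    unfolding wpow epow by (simp add: powr_add)
  finally have "w * (chi_square_density m (w * b) * chi_square_density n (w * (1 - b))) =
      w powr (?m + ?n - 1) * exp (- w / 2) * (b powr (?m - 1) * (1 - b) powr (?n - 1)) /
        (2 powr (?m + ?n) * (Gamma ?m * Gamma ?n))" .
  \<comment> \<open>\<open>Gamma (?m + ?n)\<close> divides the chi-square density and multiplies the
    beta density, so it cancels.\<close>
  moreover obtain g where g: "Gamma (?m + ?n) = g" "g \<noteq> 0" using G(3) by force
  ultimately show ?thesis
    using True assms by (simp add: chi_square_density_def beta_density_def Beta_def e g)
next
  case False
  then show ?thesis using assms by (auto simp: chi_square_density_def beta_density_def zero_less_mult_iff)
qed

text \<open>The planar change of variables splits into two affine ones on the line:
  \<open>y = w - x\<close> for fixed \<open>x\<close> and, after exchanging the integrals,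
  \<open>x = w * b\<close> for fixed \<open>w\<close>.\<close>

lemma nn_integral_chi_square_pair:
  assumes mn: "0 < m" "0 < n" and [measurable]: "case_prod f \<in> borel_measurable (borel \<Otimes>\<^sub>M borel)"
  shows "(\<integral>\<^sup>+x. \<integral>\<^sup>+y. f x y * ennreal (chi_square_density n y) \<partial>lborel * ennreal (chi_square_density m x) \<partial>lborel) =
    (\<integral>\<^sup>+w. ennreal (chi_square_density (m + n) w) *
      (\<integral>\<^sup>+b. f (w * b) (w * (1 - b)) * ennreal (beta_density (m / 2) (n / 2) b) \<partial>lborel) \<partial>lborel)"
proof -
  define c where "c k t = ennreal (chi_square_density k t)" for k t
  have [measurable]: "c k \<in> borel_measurable borel" for k unfolding c_def by measurable
  have "(\<integral>\<^sup>+x. \<integral>\<^sup>+y. f x y * c n y \<partial>lborel * c m x \<partial>lborel) =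
      (\<integral>\<^sup>+x. \<integral>\<^sup>+y. f x y * c n y * c m x \<partial>lborel \<partial>lborel)"
    by (rule nn_integral_cong) (simp add: nn_integral_multc)
  also have "\<dots> = (\<integral>\<^sup>+x. \<integral>\<^sup>+w. f x (w - x) * c n (w - x) * c m x \<partial>lborel \<partial>lborel)"
  proof (rule nn_integral_cong)
    fix x :: real
    show "(\<integral>\<^sup>+y. f x y * c n y * c m x \<partial>lborel) = (\<integral>\<^sup>+w. f x (w - x) * c n (w - x) * c m x \<partial>lborel)"
      by (subst nn_integral_real_affine[where c = 1 and t = "-x"]) auto
  qed
  also have "\<dots> = (\<integral>\<^sup>+w. \<integral>\<^sup>+x. f x (w - x) * c n (w - x) * c m x \<partial>lborel \<partial>lborel)"
    by (intro lborel_pair.Fubini') measurable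
  also have "\<dots> = (\<integral>\<^sup>+w. c (m + n) w *
      (\<integral>\<^sup>+b. f (w * b) (w * (1 - b)) * ennreal (beta_density (m / 2) (n / 2) b) \<partial>lborel) \<partial>lborel)"
  proof (rule nn_integral_cong)
    fix w :: real
    show "(\<integral>\<^sup>+x. f x (w - x) * c n (w - x) * c m x \<partial>lborel) = c (m + n) w *
        (\<integral>\<^sup>+b. f (w * b) (w * (1 - b)) * ennreal (beta_density (m / 2) (n / 2) b) \<partial>lborel)"
    proof (cases "w > 0")
      case False
      then have "c n (w - x) * c m x = 0" for x
        by (auto simp: c_def chi_square_density_def)
      then have zero: "f x (w - x) * c n (w - x) * c m x = 0" for x by (metis mult.assoc mult_zero_right)
      have "c (m + n) w = 0" using False by (simp add: c_def chi_square_density_def)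
      then show ?thesis by (simp only: zero) simp
    next
      case True
      have "(\<integral>\<^sup>+x. f x (w - x) * c n (w - x) * c m x \<partial>lborel) =
          ennreal w * (\<integral>\<^sup>+b. f (w * b) (w - w * b) * c n (w - w * b) * c m (w * b) \<partial>lborel)"
        using True by (subst nn_integral_real_affine[where c = w and t = 0]) auto
      also have "\<dots> = (\<integral>\<^sup>+b. ennreal w * (f (w * b) (w - w * b) * c n (w - w * b) * c m (w * b)) \<partial>lborel)"
        by (subst nn_integral_cmult) auto
      also have "\<dots> = (\<integral>\<^sup>+b. c (m + n) w * (f (w * b) (w * (1 - b)) * ennreal (beta_density (m / 2) (n / 2) b)) \<partial>lborel)"
      proof (rule nn_integral_cong)
        fix b :: real
        have nn: "chi_square_density n y \<ge> 0" "chi_square_density (m + n) y \<ge> 0" "chi_square_density m y \<ge> 0" for y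
          using mn by (auto intro: chi_square_density_nonneg)
        have "ennreal w * (c m (w * b) * c n (w * (1 - b))) =
            c (m + n) w * ennreal (beta_density (m / 2) (n / 2) b)"
          using chi_square_beta_factorization[OF mn True, of b] True nn
          by (simp add: c_def ennreal_mult'[symmetric])
        then show "ennreal w * (f (w * b) (w - w * b) * c n (w - w * b) * c m (w * b)) =
            c (m + n) w * (f (w * b) (w * (1 - b)) * ennreal (beta_density (m / 2) (n / 2) b))"
          by (simp add: right_diff_distrib mult_ac)
             (metis (no_types, lifting) mult.left_commute mult.commute)
      qed
      also have "\<dots> = c (m + n) w *
        (\<integral>\<^sup>+b. f (w * b) (w * (1 - b)) * ennreal (beta_density (m / 2) (n / 2) b) \<partial>lborel)"
        by (subst nn_integral_cmult) auto
      finally show ?thesis .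
    qed
  qed
  finally show ?thesis unfolding c_def .
qed

subsection \<open>The standard normal vector\<close>

lemma borel_measurable_orthogonal_transformation:
  "orthogonal_transformation T \<Longrightarrow> T \<in> borel_measurable (borel :: 'a::euclidean_space measure)"
  by (intro borel_measurable_continuous_onI linear_continuous_on
      linear_conv_bounded_linear[THEN iffD1] orthogonal_transformation_linear)

lemma nn_integral_lborel_translate:
  fixes c :: "'a::euclidean_space"
  assumes [measurable]: "f \<in> borel_measurable borel"
  shows "(\<integral>\<^sup>+y. f (c + y) \<partial>lborel) = (\<integral>\<^sup>+y. f y \<partial>lborel)"
  by (subst (2) lborel_distr_plus[of c, symmetric]) (simp add: nn_integral_distr)

text \<open>The usual uniqueness argument for translation-invariant measures: evaluate
  \<open>\<integral>\<integral> 1\<^sub>A (T u) 1\<^sub>B (y - T u) du dy\<close> in both orders, \<open>B\<close> being the unit ball.\<close>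

lemma distr_lborel_orthogonal:
  fixes T :: "'a::euclidean_space \<Rightarrow> 'a"
  assumes T: "orthogonal_transformation T"
  shows "distr lborel borel T = lborel"
proof (rule measure_eqI)
  \<comment> \<open>\<open>S y\<close> is a preimage of \<open>y\<close>: translating
    \<open>u\<close> by \<open>S y\<close> translates \<open>T u\<close> by
    \<open>y\<close>.\<close>
  obtain S where S: "\<And>x. T (S x) = x"
    using orthogonal_transformation_surj[OF T] by (metis surjD)
  have Tm [measurable]: "T \<in> borel_measurable borel"
    by (rule borel_measurable_orthogonal_transformation[OF T])
  fix A :: "'a set" assume "A \<in> sets (distr lborel borel T)"
  then have A [measurable]: "A \<in> sets borel" by simp
  define f g :: "'a \<Rightarrow> ennreal" where "f = indicator A" and "g = indicator (cball 0 1)"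
  have [measurable]: "f \<in> borel_measurable borel" "g \<in> borel_measurable borel"
    unfolding f_def g_def by (auto intro!: borel_measurable_indicator)
  define C where "C = (\<integral>\<^sup>+y. g y \<partial>lborel)"
  have C: "C = ennreal (unit_ball_vol (DIM('a)))"
    unfolding C_def g_def using emeasure_cball[of 1 "0 :: 'a"] by simp
  have "unit_ball_vol (DIM('a)) > 0" by simp
  \<comment> \<open>The volume of the unit ball is positive and finite, so it can be cancelled at
    the end.\<close>
  then have C_nz: "C \<noteq> 0" "C \<noteq> top"
    unfolding C by (simp_all del: unit_ball_vol_pos)
  have "(\<integral>\<^sup>+u. f (T u) \<partial>lborel) * C = (\<integral>\<^sup>+u. f (T u) * C \<partial>lborel)"
    by (simp add: nn_integral_multc)
  also have "\<dots> = (\<integral>\<^sup>+u. \<integral>\<^sup>+y. f (T u) * g (- T u + y) \<partial>lborel \<partial>lborel)"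
  proof (rule nn_integral_cong)
    fix u
    have "f (T u) * C = (\<integral>\<^sup>+y. f (T u) * g y \<partial>lborel)"
      unfolding C_def by (rule nn_integral_cmult[symmetric]) measurable
    also have "\<dots> = (\<integral>\<^sup>+y. f (T u) * g (- T u + y) \<partial>lborel)"
      by (rule nn_integral_lborel_translate[symmetric]) measurable
    finally show "f (T u) * C = (\<integral>\<^sup>+y. f (T u) * g (- T u + y) \<partial>lborel)" .
  qed
  also have "\<dots> = (\<integral>\<^sup>+y. \<integral>\<^sup>+u. f (T u) * g (- T u + y) \<partial>lborel \<partial>lborel)"
    by (intro lborel_pair.Fubini') measurable
  also have "\<dots> = (\<integral>\<^sup>+y. \<integral>\<^sup>+u. f (T u + y) * g (- T u) \<partial>lborel \<partial>lborel)"
  proof (rule nn_integral_cong)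
    fix y
    have T_shift: "T (S y + u) = T u + y" for u
      using orthogonal_transformation_linear[OF T] by (simp add: linear_add S)
    show "(\<integral>\<^sup>+u. f (T u) * g (- T u + y) \<partial>lborel) = (\<integral>\<^sup>+u. f (T u + y) * g (- T u) \<partial>lborel)"
      using nn_integral_lborel_translate[of "\<lambda>u. f (T u) * g (- T u + y)" "S y"]
      by (simp add: T_shift)
  qed
  also have "\<dots> = (\<integral>\<^sup>+u. \<integral>\<^sup>+y. f (T u + y) * g (- T u) \<partial>lborel \<partial>lborel)"
    by (intro lborel_pair.Fubini') measurable
  also have "\<dots> = (\<integral>\<^sup>+u. (\<integral>\<^sup>+y. f y \<partial>lborel) * g (- T u) \<partial>lborel)"
    by (simp add: nn_integral_multc nn_integral_lborel_translate[of f])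
  also have "\<dots> = (\<integral>\<^sup>+y. f y \<partial>lborel) * C"
  proof -
    \<comment> \<open>The exchange and translation steps rest on linearity and surjectivity of
      \<open>T\<close>; norm preservation enters here, where the unit ball is invariant under
      \<open>- T\<close>.\<close>
    have "g (- T u) = g u" for u
      using orthogonal_transformation_norm[OF T] by (simp add: g_def indicator_def)
    then show ?thesis by (simp add: nn_integral_cmult C_def)
  qed
  finally have "(\<integral>\<^sup>+u. f (T u) \<partial>lborel) = (\<integral>\<^sup>+y. f y \<partial>lborel)"
    using C_nz by (simp add: ennreal_mult_cancel_left mult.commute[of _ C])
  moreover have "(\<integral>\<^sup>+u. f (T u) \<partial>lborel) = (\<integral>\<^sup>+u. f u \<partial>distr lborel borel T)"
    by (simp add: nn_integral_distr)
  ultimately show "emeasure (distr lborel borel T) A = emeasure lborel A"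
    by (simp add: f_def)
qed simp

text \<open>The standard normal density in dimension \<open>k\<close> as a function of the squared
  norm \<open>s\<close>.\<close>

abbreviation (input) gauss_weight :: "real \<Rightarrow> real \<Rightarrow> real" where
  "gauss_weight k s \<equiv> (2 * pi) powr (- k / 2) * exp (- s / 2)"

lemma sets_std_normal_vec [measurable_cong, simp]: "sets std_normal_vec = sets borel"
  and space_std_normal_vec [simp]: "space std_normal_vec = UNIV"
  by (auto simp: std_normal_vec_def)

lemma norm_sum_Basis:
  "(norm (\<Sum>b\<in>Basis. x b *\<^sub>R b :: 'a::euclidean_space))\<^sup>2 = (\<Sum>b\<in>Basis. (x b)\<^sup>2)"
  by (subst power2_norm_eq_inner, subst euclidean_inner) (simp add: inner_sum_left_Basis power2_eq_square)

lemma nn_integral_std_normal_vec: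
  assumes [measurable]: "f \<in> borel_measurable borel"
  shows "(\<integral>\<^sup>+u. f u \<partial>(std_normal_vec :: (real ^ 'p) measure)) =
    (\<integral>\<^sup>+x. f (\<Sum>b\<in>Basis. x b *\<^sub>R b) * ennreal (gauss_weight CARD('p) (\<Sum>b\<in>Basis. (x b)\<^sup>2))
      \<partial>PiM (Basis :: (real ^ 'p) set) (\<lambda>_. lborel))"
proof -
  have "(\<integral>\<^sup>+u. f u \<partial>(std_normal_vec :: (real ^ 'p) measure)) =
      (\<integral>\<^sup>+u. f u * ennreal (gauss_weight CARD('p) ((norm u)\<^sup>2)) \<partial>lborel)"
    unfolding std_normal_vec_def by (subst nn_integral_density) (auto simp: mult.commute)
  also have "\<dots> = (\<integral>\<^sup>+x. f (\<Sum>b\<in>Basis. x b *\<^sub>R b) *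
      ennreal (gauss_weight CARD('p) ((norm (\<Sum>b\<in>Basis. x b *\<^sub>R b :: real ^ 'p))\<^sup>2))
      \<partial>PiM (Basis :: (real ^ 'p) set) (\<lambda>_. lborel))"
    by (subst lborel_eq, subst nn_integral_distr) auto
  also have "\<dots> = (\<integral>\<^sup>+x. f (\<Sum>b\<in>Basis. x b *\<^sub>R b) * ennreal (gauss_weight CARD('p) (\<Sum>b\<in>Basis. (x b)\<^sup>2))
      \<partial>PiM (Basis :: (real ^ 'p) set) (\<lambda>_. lborel))"
    by (simp add: norm_sum_Basis)
  finally show ?thesis .
qed

lemma nn_integral_std_normal_norm:
  assumes [measurable]: "f \<in> borel_measurable borel"
  shows "(\<integral>\<^sup>+u. f ((norm u)\<^sup>2) \<partial>(std_normal_vec :: (real ^ 'p) measure)) =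
    (\<integral>\<^sup>+t. f t * ennreal (chi_square_density CARD('p) t) \<partial>lborel)"
proof -
  show ?thesis
    using nn_integral_sqsum_gauss[of "Basis :: (real ^ 'p) set" f]
    by (subst nn_integral_std_normal_vec) (auto simp: norm_sum_Basis)
qed

text \<open>The weight factorizes over complementary blocks of coordinates, since both the squared
  norm and the dimension add up. Each block is then handled by
  \<open>nn_integral_sqsum_gauss\<close>, which asks for it to be nonempty.\<close>

lemma nn_integral_std_normal_split:
  assumes A: "A \<subseteq> Basis" "A \<noteq> {}" "A \<noteq> Basis"
    and [measurable]: "case_prod f \<in> borel_measurable (borel \<Otimes>\<^sub>M borel)"
  shows "(\<integral>\<^sup>+u. f (\<Sum>b\<in>A. (u \<bullet> b)\<^sup>2) (\<Sum>b\<in>Basis - A. (u \<bullet> b)\<^sup>2) \<partial>(std_normal_vec :: (real ^ 'p) measure)) =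
    (\<integral>\<^sup>+x. \<integral>\<^sup>+y. f x y * ennreal (chi_square_density (card (Basis - A)) y) \<partial>lborel *
       ennreal (chi_square_density (card A) x) \<partial>lborel)"
proof -
  interpret product_sigma_finite "\<lambda>_. lborel :: real measure" ..
  define B where "B = Basis - A"
  have AB: "A \<inter> B = {}" "A \<union> B = Basis" "finite A" "finite B" "A \<noteq> {}" "B \<noteq> {}"
    using A finite_subset[OF A(1)] by (auto simp: B_def)
  have card: "CARD('p) = card A + card B"
    using card_Un_disjoint[OF AB(3,4,1)] AB(2) by simp
  have ip: "(\<Sum>b\<in>Basis. x b *\<^sub>R b :: real ^ 'p) \<bullet> c = x c" if "c \<in> Basis" for x c
    using that by (simp add: inner_sum_left_Basis)
  have "(\<integral>\<^sup>+u. f (\<Sum>b\<in>A. (u \<bullet> b)\<^sup>2) (\<Sum>b\<in>B. (u \<bullet> b)\<^sup>2) \<partial>(std_normal_vec :: (real ^ 'p) measure)) =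
      (\<integral>\<^sup>+x. f (\<Sum>b\<in>A. (x b)\<^sup>2) (\<Sum>b\<in>B. (x b)\<^sup>2) *
        ennreal (gauss_weight CARD('p) (\<Sum>b\<in>Basis. (x b)\<^sup>2)) \<partial>PiM (A \<union> B) (\<lambda>_. lborel))"
  proof -
    have E: "(\<Sum>b\<in>C. ((\<Sum>b\<in>Basis. x b *\<^sub>R b :: real ^ 'p) \<bullet> b)\<^sup>2) = (\<Sum>b\<in>C. (x b)\<^sup>2)" if "C \<subseteq> Basis" for C x
      using that by (intro sum.cong) (auto simp: ip)
    have "B \<subseteq> Basis" by (auto simp: B_def)
    have "(\<lambda>u. f (\<Sum>b\<in>A. (u \<bullet> b)\<^sup>2) (\<Sum>b\<in>B. (u \<bullet> b)\<^sup>2)) \<in> borel_measurable (borel :: (real ^ 'p) measure)"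
      by measurable
    from nn_integral_std_normal_vec[OF this] show ?thesis
      unfolding E[OF A(1)] E[OF \<open>B \<subseteq> Basis\<close>] AB(2) .
  qed
  also have "\<dots> = (\<integral>\<^sup>+x. \<integral>\<^sup>+y. f (\<Sum>b\<in>A. (x b)\<^sup>2) (\<Sum>b\<in>B. (y b)\<^sup>2) *
        ennreal (gauss_weight (card A) (\<Sum>b\<in>A. (x b)\<^sup>2)) * ennreal (gauss_weight (card B) (\<Sum>b\<in>B. (y b)\<^sup>2))
        \<partial>PiM B (\<lambda>_. lborel) \<partial>PiM A (\<lambda>_. lborel))"
  proof (subst product_nn_integral_fold[OF AB(1,3,4)])
    have w: "gauss_weight CARD('p) (s + t) = gauss_weight (card A) s * gauss_weight (card B) t" for s t
    proof -
      have "- real CARD('p) / 2 = - real (card A) / 2 + - real (card B) / 2"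
        "- (s + t) / 2 = - s / 2 + - t / 2"
        by (simp_all add: card field_simps)
      then show ?thesis by (simp only: powr_add exp_add mult_ac)
    qed
    have sA: "(\<Sum>b\<in>A. (merge A B (x, y) b)\<^sup>2) = (\<Sum>b\<in>A. (x b)\<^sup>2)" for x y
      using AB(1) by (intro sum.cong) auto
    have sB: "(\<Sum>b\<in>B. (merge A B (x, y) b)\<^sup>2) = (\<Sum>b\<in>B. (y b)\<^sup>2)" for x y
      using AB(1) by (intro sum.cong) auto
    have s: "(\<Sum>b\<in>Basis. (merge A B (x, y) b)\<^sup>2) = (\<Sum>b\<in>A. (x b)\<^sup>2) + (\<Sum>b\<in>B. (y b)\<^sup>2)" for x y
      using sum.union_disjoint[OF AB(3,4,1), of "\<lambda>b. (merge A B (x, y) b)\<^sup>2"] by (simp add: AB(2) sA sB)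
    show "(\<integral>\<^sup>+x. \<integral>\<^sup>+y. f (\<Sum>b\<in>A. (merge A B (x, y) b)\<^sup>2) (\<Sum>b\<in>B. (merge A B (x, y) b)\<^sup>2) *
         ennreal (gauss_weight CARD('p) (\<Sum>b\<in>Basis. (merge A B (x, y) b)\<^sup>2))
         \<partial>PiM B (\<lambda>_. lborel) \<partial>PiM A (\<lambda>_. lborel)) = (\<integral>\<^sup>+x. \<integral>\<^sup>+y. f (\<Sum>b\<in>A. (x b)\<^sup>2) (\<Sum>b\<in>B. (y b)\<^sup>2) *
        ennreal (gauss_weight (card A) (\<Sum>b\<in>A. (x b)\<^sup>2)) * ennreal (gauss_weight (card B) (\<Sum>b\<in>B. (y b)\<^sup>2))
        \<partial>PiM B (\<lambda>_. lborel) \<partial>PiM A (\<lambda>_. lborel))"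
      unfolding s sA sB w by (subst ennreal_mult) (simp_all add: mult.assoc)
    have sum_meas: "(\<lambda>x. \<Sum>b\<in>C. (x b)\<^sup>2) \<in> borel_measurable (PiM (A \<union> B) (\<lambda>_. lborel :: real measure))"
      if "C \<subseteq> A \<union> B" for C
    proof (intro borel_measurable_sum borel_measurable_power)
      fix b assume "b \<in> C"
      then have "b \<in> A \<union> B" using that by blast
      from measurable_component_singleton[OF this, of "\<lambda>_. lborel :: real measure"]
      show "(\<lambda>x. x b) \<in> borel_measurable (PiM (A \<union> B) (\<lambda>_. lborel :: real measure))" by simp
    qed
    have [measurable]: "(\<lambda>x. \<Sum>b\<in>A. (x b)\<^sup>2) \<in> borel_measurable (PiM (A \<union> B) (\<lambda>_. lborel :: real measure))"
      "(\<lambda>x. \<Sum>b\<in>B. (x b)\<^sup>2) \<in> borel_measurable (PiM (A \<union> B) (\<lambda>_. lborel :: real measure))"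
      "(\<lambda>x. \<Sum>b\<in>Basis. (x b)\<^sup>2) \<in> borel_measurable (PiM (A \<union> B) (\<lambda>_. lborel :: real measure))"
      by (rule sum_meas, use AB(2) in blast)+
    show "(\<lambda>x. f (\<Sum>b\<in>A. (x b)\<^sup>2) (\<Sum>b\<in>B. (x b)\<^sup>2) *
        ennreal (gauss_weight CARD('p) (\<Sum>b\<in>Basis. (x b)\<^sup>2))) \<in> borel_measurable (PiM (A \<union> B) (\<lambda>_. lborel))"
      by measurable
  qed
  also have "\<dots> = (\<integral>\<^sup>+x. (\<integral>\<^sup>+t. f (\<Sum>b\<in>A. (x b)\<^sup>2) t * ennreal (chi_square_density (card B) t) \<partial>lborel) *
        ennreal (gauss_weight (card A) (\<Sum>b\<in>A. (x b)\<^sup>2)) \<partial>PiM A (\<lambda>_. lborel))"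
  proof (rule nn_integral_cong)
    fix x :: "real ^ 'p \<Rightarrow> real"
    let ?s = "\<Sum>b\<in>A. (x b)\<^sup>2"
    have "(\<integral>\<^sup>+y. f ?s (\<Sum>b\<in>B. (y b)\<^sup>2) * ennreal (gauss_weight (card A) ?s) * ennreal (gauss_weight (card B) (\<Sum>b\<in>B. (y b)\<^sup>2))
        \<partial>PiM B (\<lambda>_. lborel)) =
        (\<integral>\<^sup>+y. f ?s (\<Sum>b\<in>B. (y b)\<^sup>2) * ennreal (gauss_weight (card B) (\<Sum>b\<in>B. (y b)\<^sup>2)) * ennreal (gauss_weight (card A) ?s)
        \<partial>PiM B (\<lambda>_. lborel))"
      by (simp add: mult_ac)
    also have "\<dots> = (\<integral>\<^sup>+y. f ?s (\<Sum>b\<in>B. (y b)\<^sup>2) * ennreal (gauss_weight (card B) (\<Sum>b\<in>B. (y b)\<^sup>2)) \<partial>PiM B (\<lambda>_. lborel)) *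
        ennreal (gauss_weight (card A) ?s)"
      by (rule nn_integral_multc) measurable
    also have "\<dots> = (\<integral>\<^sup>+t. f ?s t * ennreal (chi_square_density (card B) t) \<partial>lborel) * ennreal (gauss_weight (card A) ?s)"
      using nn_integral_sqsum_gauss[OF AB(4,6), of "f ?s"] by simp
    finally show "(\<integral>\<^sup>+y. f ?s (\<Sum>b\<in>B. (y b)\<^sup>2) * ennreal (gauss_weight (card A) ?s) * ennreal (gauss_weight (card B) (\<Sum>b\<in>B. (y b)\<^sup>2))
        \<partial>PiM B (\<lambda>_. lborel)) =
        (\<integral>\<^sup>+t. f ?s t * ennreal (chi_square_density (card B) t) \<partial>lborel) * ennreal (gauss_weight (card A) ?s)" .
  qed
  also have "\<dots> = (\<integral>\<^sup>+x. \<integral>\<^sup>+y. f x y * ennreal (chi_square_density (card B) y) \<partial>lborel *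
       ennreal (chi_square_density (card A) x) \<partial>lborel)"
    using nn_integral_sqsum_gauss[OF AB(3,5), of "\<lambda>x. \<integral>\<^sup>+y. f x y * ennreal (chi_square_density (card B) y) \<partial>lborel"] by simp
  finally show ?thesis unfolding B_def .
qed

text \<open>In coordinates the density is a product of one-dimensional normal densities, each of
  total mass 1.\<close>

lemma prob_space_std_normal_vec: "prob_space (std_normal_vec :: (real ^ 'p) measure)"
proof
  interpret product_sigma_finite "\<lambda>_. lborel :: real measure" ..
  have d: "ennreal (gauss_weight CARD('p) (\<Sum>b\<in>(Basis :: (real ^ 'p) set). (x b)\<^sup>2)) =
      (\<Prod>b\<in>(Basis :: (real ^ 'p) set). ennreal (normal_density 0 1 (x b)))" for x
  proof -
    have "(\<Prod>b\<in>(Basis :: (real ^ 'p) set). normal_density 0 1 (x b)) =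
        (\<Prod>b\<in>(Basis :: (real ^ 'p) set). 1 / sqrt (2 * pi)) * (\<Prod>b\<in>Basis. exp (- (x b)\<^sup>2 / 2))"
      by (simp only: normal_density_def prod.distrib[symmetric]) simp
    also have "\<dots> = (2 * pi) powr (- CARD('p) / 2) * exp (- (\<Sum>b\<in>Basis. (x b)\<^sup>2) / 2)"
    proof -
      have "(1 / sqrt (2 * pi)) ^ CARD('p) = (2 * pi) powr (- CARD('p) / 2)"
        by (simp add: powr_half_sqrt[symmetric] powr_minus_divide[symmetric] powr_realpow[symmetric] powr_powr)
      moreover have "- (\<Sum>b\<in>(Basis :: (real ^ 'p) set). (x b)\<^sup>2) / 2 = (\<Sum>b\<in>Basis. - (x b)\<^sup>2 / 2)"
        by (simp add: sum_negf sum_divide_distrib)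
      ultimately show ?thesis by (simp add: exp_sum)
    qed
    finally show ?thesis by (simp add: prod_ennreal)
  qed
  have "(\<integral>\<^sup>+x. ennreal (normal_density 0 1 x) \<partial>lborel) = 1"
    using prob_space.emeasure_space_1[OF prob_space_normal_density[of 1 0]] by (simp add: emeasure_density)
  then have "(\<integral>\<^sup>+x. (\<Prod>b\<in>(Basis :: (real ^ 'p) set). ennreal (normal_density 0 1 (x b))) \<partial>PiM Basis (\<lambda>_. lborel)) = 1"
    by (subst product_nn_integral_prod) auto
  moreover have "(\<integral>\<^sup>+u. 1 \<partial>(std_normal_vec :: (real ^ 'p) measure)) =
      (\<integral>\<^sup>+x. 1 * ennreal (gauss_weight CARD('p) (\<Sum>b\<in>(Basis :: (real ^ 'p) set). (x b)\<^sup>2)) \<partial>PiM Basis (\<lambda>_. lborel))"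
    by (rule nn_integral_std_normal_vec) simp
  ultimately have "(\<integral>\<^sup>+u. 1 \<partial>(std_normal_vec :: (real ^ 'p) measure)) = 1"
    by (simp only: d mult_1)
  then show "emeasure (std_normal_vec :: (real ^ 'p) measure) (space std_normal_vec) = 1" by simp
qed

text \<open>The density depends on the norm alone, so it may be written in terms of
  \<open>T v\<close>; it then moves past the push-forward, and Lebesgue measure is invariant under
  \<open>T\<close>.\<close>

lemma distr_std_normal_orthogonal:
  fixes T :: "real ^ 'n \<Rightarrow> real ^ 'n"
  assumes T: "orthogonal_transformation T"
  shows "distr std_normal_vec borel T = std_normal_vec"
proof -
  note [measurable] = borel_measurable_orthogonal_transformation[OF T]
  have "distr (density lborel (\<lambda>v. ennreal (gauss_weight CARD('n) ((norm (T v))\<^sup>2)))) borel T =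
      density (distr lborel borel T) (\<lambda>v. ennreal (gauss_weight CARD('n) ((norm v)\<^sup>2)))"
    by (rule density_distr[symmetric]) auto
  then show ?thesis
    unfolding distr_lborel_orthogonal[OF T] orthogonal_transformation_norm[OF T]
    by (simp add: std_normal_vec_def)
qed

subsection \<open>Orthogonal projections\<close>

text \<open>The rank is encoded as the trace, a continuous function, so that the projections of rank \<open>r\<close>
  visibly form a closed set.\<close>

definition orth_proj :: "real \<Rightarrow> real ^ 'p ^ 'p \<Rightarrow> bool" where
  "orth_proj r P \<longleftrightarrow> transpose P = P \<and> P ** P = P \<and> trace P = r"

lemma orth_proj_idem: "orth_proj r P \<Longrightarrow> P *v (P *v u) = P *v u"
  by (simp add: orth_proj_def matrix_vector_mul_assoc)

lemma orth_proj_inner: "orth_proj r P \<Longrightarrow> (P *v u) \<bullet> v = u \<bullet> (P *v v)"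
  by (metis dot_lmul_matrix orth_proj_def vector_transpose_matrix)

lemma orth_proj_inner_complement: "orth_proj r P \<Longrightarrow> (P *v u) \<bullet> (v - P *v v) = 0"
  by (simp add: orth_proj_inner orth_proj_idem matrix_vector_mult_diff_distrib)

lemma orth_proj_norm: "orth_proj r P \<Longrightarrow> (norm (P *v u))\<^sup>2 + (norm (u - P *v u))\<^sup>2 = (norm u)\<^sup>2"
  using norm_add_Pythagorean[of "P *v u" "u - P *v u"]
  by (simp add: orthogonal_def orth_proj_inner_complement)

lemma parseval_span:
  fixes B :: "'a::euclidean_space set"
  assumes "finite B" "pairwise orthogonal B" "\<And>b. b \<in> B \<Longrightarrow> norm b = 1" "u \<in> span B"
  shows "(norm u)\<^sup>2 = (\<Sum>b\<in>B. (u \<bullet> b)\<^sup>2)"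
proof -
  have "u \<bullet> u = (\<Sum>b\<in>B. (u \<bullet> b) *\<^sub>R b) \<bullet> u"
    using orthonormal_basis_expand[OF assms(2,3,4,1)] by simp
  also have "\<dots> = (\<Sum>b\<in>B. (u \<bullet> b)\<^sup>2)"
    by (subst inner_sum_left) (simp add: power2_eq_square inner_commute)
  finally show ?thesis by (simp add: power2_norm_eq_inner)
qed

lemma trace_eq_sum_Basis: "trace (P :: real ^ 'p ^ 'p) = (\<Sum>e\<in>Basis. e \<bullet> (P *v e))"
proof -
  have "(\<Sum>e\<in>Basis. e \<bullet> (P *v e)) = (\<Sum>i\<in>UNIV. axis i 1 \<bullet> (P *v axis i 1))"
    by (simp add: Basis_vec_def UNION_singleton_eq_range sum.reindex inj_on_def axis_eq_axis)
  then show ?thesis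
    by (simp add: trace_def inner_axis' matrix_vector_mult_basis column_def)
qed

text \<open>Orthonormal bases of the range and of the kernel of \<open>P\<close> together form one
  of the whole space. \<open>T\<close> carries it to the standard basis, and \<open>A\<close> is the
  part that receives the range.\<close>

lemma orth_proj_adapted_basis:
  fixes P :: "real ^ 'p ^ 'p"
  assumes P: "orth_proj r P"
  obtains T A where "orthogonal_transformation T" "A \<subseteq> (Basis :: (real ^ 'p) set)" "real (card A) = r"
    "\<And>u. (norm (P *v u))\<^sup>2 = (\<Sum>b\<in>A. (T u \<bullet> b)\<^sup>2)"
    "\<And>u. (norm (u - P *v u))\<^sup>2 = (\<Sum>b\<in>Basis - A. (T u \<bullet> b)\<^sup>2)"
proof -
  define V where "V = range ((*v) P)"
  define W where "W = {v. P *v v = 0}"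
  have "subspace V" unfolding V_def
    by (intro linear_subspace_image) (auto simp: subspace_UNIV)
  then obtain B1 where B1: "B1 \<subseteq> V" "pairwise orthogonal B1" "\<And>x. x \<in> B1 \<Longrightarrow> norm x = 1"
    "independent B1" "span B1 = V"
    by (metis orthonormal_basis_subspace)
  have "subspace W" unfolding W_def
    by (auto simp: subspace_def matrix_vector_right_distrib matrix_vector_mult_scaleR)
  then obtain B2 where B2: "B2 \<subseteq> W" "pairwise orthogonal B2" "\<And>x. x \<in> B2 \<Longrightarrow> norm x = 1"
    "independent B2" "span B2 = W"
    by (metis orthonormal_basis_subspace)
  have PV: "P *v v = v" if "v \<in> V" for v
    using that orth_proj_idem[OF P] by (auto simp: V_def)
  have VW: "v \<bullet> w = 0" if "v \<in> V" "w \<in> W" for v w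
    using orth_proj_inner[OF P, of v w] PV[OF that(1)] that(2) by (simp add: W_def)
  have disj: "B1 \<inter> B2 = {}"
    using B1(1,3) B2(1) VW by (metis disjoint_iff inner_eq_zero_iff norm_zero subset_iff zero_neq_one)
  define B where "B = B1 \<union> B2"
  have fin: "finite B1" "finite B2" "finite B"
    using B1(4) B2(4) by (auto simp: B_def independent_imp_finite)
  have norm1: "norm b = 1" if "b \<in> B" for b using that B1(3) B2(3) by (auto simp: B_def)
  have orth: "pairwise orthogonal B"
    using B1(1,2) B2(1,2) VW unfolding B_def pairwise_def orthogonal_def
    by (metis Un_iff inner_commute subset_iff)
  have span: "span B = UNIV"
  proof -
    have "u \<in> span B" for u
    proof -
      have "P *v u \<in> span B1" "u - P *v u \<in> span B2"
        unfolding B1(5) B2(5) by (auto simp: V_def W_def matrix_vector_mult_diff_distrib orth_proj_idem[OF P])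
      then have "P *v u \<in> span B" "u - P *v u \<in> span B"
        unfolding B_def by (meson span_mono subsetD sup.cobounded1 sup.cobounded2)+
      from span_add[OF this] show ?thesis by simp
    qed
    then show ?thesis by auto
  qed
  have "independent B"
    using orth norm1 by (intro pairwise_orthogonal_independent) force+
  then have "card B = DIM(real ^ 'p)"
    using span by (metis dim_UNIV dim_span_eq_card_independent)
  then obtain \<phi> where \<phi>: "bij_betw \<phi> (Basis :: (real ^ 'p) set) B"
    using fin(3) by (metis finite_same_card_bij finite_Basis)
  \<comment> \<open>\<open>T u\<close> lists the coefficients of \<open>u\<close> in the basis
    \<open>B\<close>, so norm preservation is Parseval's identity.\<close>
  define T where "T u = (\<Sum>b\<in>Basis. (u \<bullet> \<phi> b) *\<^sub>R b)" for u :: "real ^ 'p"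
  have T_inner: "T u \<bullet> b = u \<bullet> \<phi> b" if "b \<in> Basis" for u b
    using that by (simp add: T_def inner_sum_left_Basis)
  have T_norm: "norm (T u) = norm u" for u
  proof -
    have "(norm (T u))\<^sup>2 = (\<Sum>b\<in>Basis. (u \<bullet> \<phi> b)\<^sup>2)" unfolding T_def by (rule norm_sum_Basis)
    also have "\<dots> = (\<Sum>c\<in>B. (u \<bullet> c)\<^sup>2)" by (rule sum.reindex_bij_betw[OF \<phi>])
    also have "\<dots> = (norm u)\<^sup>2" using parseval_span[OF fin(3) orth norm1] span by simp
    finally show ?thesis by simp
  qed
  have "linear T"
    unfolding T_def by (auto intro!: linearI simp: inner_add_left scaleR_add_left sum.distrib scaleR_sum_right)
  then have T: "orthogonal_transformation T" using T_norm by (simp add: orthogonal_transformation)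
  define A where "A = {b \<in> Basis. \<phi> b \<in> B1}"
  have bA: "bij_betw \<phi> A B1" and bC: "bij_betw \<phi> (Basis - A) B2"
  proof -
    have "\<phi> ` Basis = B1 \<union> B2" "inj_on \<phi> Basis" using \<phi> by (auto simp: bij_betw_def B_def)
    have "\<phi> ` A = B1"
    proof
      show "B1 \<subseteq> \<phi> ` A"
      proof
        fix c assume "c \<in> B1"
        moreover from this obtain b where "b \<in> Basis" "c = \<phi> b" using \<open>\<phi> ` Basis = B1 \<union> B2\<close> by blast
        ultimately show "c \<in> \<phi> ` A" by (auto simp: A_def)
      qed
    qed (auto simp: A_def)
    moreover have "\<phi> ` (Basis - A) = \<phi> ` Basis - \<phi> ` A"
      using \<open>inj_on \<phi> Basis\<close> by (intro inj_on_image_set_diff) (auto simp: A_def)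
    then have "\<phi> ` (Basis - A) = B2"
      using \<open>\<phi> ` Basis = B1 \<union> B2\<close> \<open>\<phi> ` A = B1\<close> disj by blast
    ultimately show "bij_betw \<phi> A B1" "bij_betw \<phi> (Basis - A) B2"
      using \<open>inj_on \<phi> Basis\<close> by (auto simp: bij_betw_def A_def inj_on_def)
  qed
  have eqP: "(norm (P *v u))\<^sup>2 = (\<Sum>c\<in>B1. (u \<bullet> c)\<^sup>2)" for u
  proof -
    have "(norm (P *v u))\<^sup>2 = (\<Sum>c\<in>B1. ((P *v u) \<bullet> c)\<^sup>2)"
      using B1(5) by (intro parseval_span[OF fin(1) B1(2,3)]) (auto simp: V_def)
    also have "\<dots> = (\<Sum>c\<in>B1. (u \<bullet> c)\<^sup>2)"
      using B1(1) PV by (intro sum.cong) (auto simp: orth_proj_inner[OF P])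
    finally show ?thesis .
  qed
  have eqC: "(norm (u - P *v u))\<^sup>2 = (\<Sum>c\<in>B2. (u \<bullet> c)\<^sup>2)" for u
  proof -
    have "(norm (u - P *v u))\<^sup>2 = (\<Sum>c\<in>B2. ((u - P *v u) \<bullet> c)\<^sup>2)"
      using B2(5) by (intro parseval_span[OF fin(2) B2(2,3)])
        (auto simp: W_def matrix_vector_mult_diff_distrib orth_proj_idem[OF P])
    also have "\<dots> = (\<Sum>c\<in>B2. (u \<bullet> c)\<^sup>2)"
      using B2(1) by (intro sum.cong) (auto simp: W_def inner_diff_left orth_proj_inner[OF P])
    finally show ?thesis .
  qed
  \<comment> \<open>Double counting of \<open>(c \<bullet> e)\<^sup>2\<close> over
    \<open>c \<in> B1\<close> and \<open>e \<in> Basis\<close>: the sum for fixed \<open>e\<close>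
    is \<open>(norm (P *v e))\<^sup>2\<close>, the sum for fixed \<open>c\<close> is 1.\<close>
  have "trace P = (\<Sum>e\<in>Basis. (norm (P *v e))\<^sup>2)"
    using P by (simp add: trace_eq_sum_Basis power2_norm_eq_inner orth_proj_inner orth_proj_idem)
  also have "\<dots> = (\<Sum>c\<in>B1. \<Sum>e\<in>Basis. (c \<bullet> e)\<^sup>2)"
    unfolding eqP by (subst sum.swap) (simp add: inner_commute)
  also have "\<dots> = real (card B1)"
  proof -
    have "(\<Sum>e\<in>Basis. (c \<bullet> e)\<^sup>2) = 1" if "c \<in> B1" for c
      using euclidean_inner[of c c] B1(3)[OF that] by (simp add: power2_eq_square dot_square_norm)
    then show ?thesis by simp
  qed
  finally have "real (card A) = r"
    using P bij_betw_same_card[OF bA] by (simp add: orth_proj_def)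
  moreover have "A \<subseteq> Basis" by (auto simp: A_def)
  moreover have "(norm (P *v u))\<^sup>2 = (\<Sum>b\<in>A. (T u \<bullet> b)\<^sup>2)" for u
    unfolding eqP sum.reindex_bij_betw[OF bA, symmetric]
    by (intro sum.cong) (auto simp: T_inner A_def)
  moreover have "(norm (u - P *v u))\<^sup>2 = (\<Sum>b\<in>Basis - A. (T u \<bullet> b)\<^sup>2)" for u
    unfolding eqC sum.reindex_bij_betw[OF bC, symmetric]
    by (intro sum.cong) (auto simp: T_inner A_def)
  ultimately show thesis by (intro that[of T A]) (rule T | simp)+
qed

text \<open>After the rotation \<open>T\<close> the two components are complementary blocks of
  coordinates. As \<open>P\<close> is absent from the right-hand side, this yields the law of the
  support function and also its independence of \<open>P\<close>.\<close>

lemma nn_integral_std_normal_proj: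
  fixes P :: "real ^ 'p ^ 'p"
  assumes P: "orth_proj (real r) P" and r: "0 < r" "r < CARD('p)"
    and f [measurable]: "case_prod f \<in> borel_measurable (borel \<Otimes>\<^sub>M borel)"
  shows "(\<integral>\<^sup>+u. f ((norm (P *v u))\<^sup>2) ((norm (u - P *v u))\<^sup>2) \<partial>std_normal_vec) =
    (\<integral>\<^sup>+w. ennreal (chi_square_density CARD('p) w) *
      (\<integral>\<^sup>+b. f (w * b) (w * (1 - b)) * ennreal (beta_density (r / 2) (real (CARD('p) - r) / 2) b) \<partial>lborel) \<partial>lborel)"
proof -
  obtain T A where T: "orthogonal_transformation T" and A: "A \<subseteq> (Basis :: (real ^ 'p) set)" "card A = r"
    and eq: "\<And>u. (norm (P *v u))\<^sup>2 = (\<Sum>b\<in>A. (T u \<bullet> b)\<^sup>2)"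
      "\<And>u. (norm (u - P *v u))\<^sup>2 = (\<Sum>b\<in>Basis - A. (T u \<bullet> b)\<^sup>2)"
    by (rule orth_proj_adapted_basis[OF P]) auto
  note [measurable] = borel_measurable_orthogonal_transformation[OF T]
  have c: "card ((Basis :: (real ^ 'p) set) - A) = CARD('p) - r"
    using A finite_subset[OF A(1)] by (subst card_Diff_subset) auto
  have ne: "A \<noteq> {}" "A \<noteq> Basis" using A r by auto
  have "(\<integral>\<^sup>+u. f ((norm (P *v u))\<^sup>2) ((norm (u - P *v u))\<^sup>2) \<partial>std_normal_vec) =
      (\<integral>\<^sup>+u. f (\<Sum>b\<in>A. (u \<bullet> b)\<^sup>2) (\<Sum>b\<in>Basis - A. (u \<bullet> b)\<^sup>2) \<partial>distr std_normal_vec borel T)"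
    unfolding eq by (subst nn_integral_distr) auto
  also have "\<dots> = (\<integral>\<^sup>+u. f (\<Sum>b\<in>A. (u \<bullet> b)\<^sup>2) (\<Sum>b\<in>Basis - A. (u \<bullet> b)\<^sup>2) \<partial>std_normal_vec)"
    unfolding distr_std_normal_orthogonal[OF T] ..
  finally show ?thesis
    unfolding nn_integral_std_normal_split[OF A(1) ne f] A(2) c
    using nn_integral_chi_square_pair[of r "CARD('p) - r" f] r by simp
qed

text \<open>A trace equal to the dimension forces \<open>A = Basis\<close>, so the complementary
  component is an empty sum.\<close>

lemma orth_proj_full:
  fixes P :: "real ^ 'p ^ 'p"
  assumes P: "orth_proj CARD('p) P"
  shows "P *v u = u"
proof -
  obtain T A where A: "A \<subseteq> (Basis :: (real ^ 'p) set)" "card A = CARD('p)"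
    and eq: "\<And>u. (norm (u - P *v u))\<^sup>2 = (\<Sum>b\<in>Basis - A. (T u \<bullet> b)\<^sup>2)"
    by (rule orth_proj_adapted_basis[OF P]) auto
  have "A = Basis" using A by (intro card_subset_eq) auto
  then show ?thesis using eq[of u] by simp
qed

subsection \<open>The support function of a cone\<close>

text \<open>For an orthogonal projection \<open>P\<close>, \<open>cone_support a (norm (P u)) (norm (u - P u))\<close> is the maximum of
  \<open>y \<bullet> u\<close> over the unit vectors \<open>y\<close> whose angle with the range of \<open>P\<close> has cosine at least \<open>a\<close>. The
  two squares are the coordinates of \<open>(s, q)\<close> in the basis \<open>(a, sqrt (1 - a\<^sup>2))\<close>, \<open>(sqrt (1 - a\<^sup>2), - a)\<close>, the
  second one cut off at 0; this avoids a case distinction on whether \<open>u\<close> itself lies in the cone.\<close>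

definition cone_support :: "real \<Rightarrow> real \<Rightarrow> real \<Rightarrow> real" where
  "cone_support a s q = sqrt ((a * s + sqrt (1 - a\<^sup>2) * q)\<^sup>2 + (max 0 (sqrt (1 - a\<^sup>2) * s - a * q))\<^sup>2)"

section \<open>Plane geometry of the cone, with \<open>a\<close> as cosine and \<open>a'\<close> as
  sine\<close>

context
  fixes a a' :: real
  assumes a: "0 \<le> a" "a \<le> 1" and a'_def: "a' = sqrt (1 - a\<^sup>2)"
begin

lemma cos_sin_props: "0 \<le> a'" "a\<^sup>2 + a'\<^sup>2 = 1"
  using a by (auto simp: a'_def abs_square_le_1)

lemma cone_rotation: "(a * s + a' * q)\<^sup>2 + (a' * s - a * q)\<^sup>2 = s\<^sup>2 + q\<^sup>2"
proof -
  have "(a * s + a' * q)\<^sup>2 + (a' * s - a * q)\<^sup>2 = (a\<^sup>2 + a'\<^sup>2) * (s\<^sup>2 + q\<^sup>2)"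
    by (simp add: power2_eq_square algebra_simps)
  then show ?thesis by (simp add: cos_sin_props)
qed

text \<open>The point lies in the cone and its own direction is the maximizer: the cut-off is
  inactive and the rotation preserves the norm.\<close>

lemma cone_support_right: "a' * s \<ge> a * q \<Longrightarrow> cone_support a s q = sqrt (s\<^sup>2 + q\<^sup>2)"
  using cone_rotation[of s q] by (simp add: cone_support_def a'_def[symmetric])

text \<open>Outside the cone the cut-off removes the second coordinate; the maximizer is the
  boundary direction with components \<open>a\<close> and \<open>a'\<close>.\<close>

lemma cone_support_left:
  "a' * s \<le> a * q \<Longrightarrow> 0 \<le> s \<Longrightarrow> 0 \<le> q \<Longrightarrow> cone_support a s q = a * s + a' * q"
  using a cos_sin_props by (simp add: cone_support_def a'_def[symmetric] max_def)

lemma cone_support_le: "cone_support a s q \<le> sqrt (s\<^sup>2 + q\<^sup>2)"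
proof -
  have "(max 0 (a' * s - a * q))\<^sup>2 \<le> (a' * s - a * q)\<^sup>2"
    by (auto simp: max_def)
  then show ?thesis using cone_rotation[of s q] by (simp add: cone_support_def a'_def[symmetric])
qed

lemma cone_support_scale: "0 \<le> k \<Longrightarrow> cone_support a (k * s) (k * q) = k * cone_support a s q"
proof -
  assume k: "0 \<le> k"
  have "max 0 (a' * (k * s) - a * (k * q)) = k * max 0 (a' * s - a * q)"
    using k by (simp add: max_mult_distrib_left algebra_simps)
  then have "(a * (k * s) + a' * (k * q))\<^sup>2 + (max 0 (a' * (k * s) - a * (k * q)))\<^sup>2 =
      k\<^sup>2 * ((a * s + a' * q)\<^sup>2 + (max 0 (a' * s - a * q))\<^sup>2)"
    by (simp add: power_mult_distrib algebra_simps power2_eq_square)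
  then show ?thesis using k by (simp add: cone_support_def a'_def[symmetric] real_sqrt_mult)
qed

text \<open>\<open>cone_support\<close> is the Euclidean norm of the transformed and cut-off pair;
  the transformation is an isometry and the cut-off does not increase distances.\<close>

lemma cone_support_diff_le:
  "\<bar>cone_support a s q - cone_support a s2 q2\<bar> \<le> \<bar>s - s2\<bar> + \<bar>q - q2\<bar>"
proof -
  let ?x = "max 0 (a' * s - a * q)" and ?y = "a * s + a' * q"
  let ?x2 = "max 0 (a' * s2 - a * q2)" and ?y2 = "a * s2 + a' * q2"
  have "\<bar>norm (?y, ?x) - norm (?y2, ?x2)\<bar> \<le> norm ((?y, ?x) - (?y2, ?x2))"
    by (rule norm_triangle_ineq3)
  then have "\<bar>cone_support a s q - cone_support a s2 q2\<bar> \<le> sqrt ((?y - ?y2)\<^sup>2 + (?x - ?x2)\<^sup>2)"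
    by (simp add: cone_support_def a'_def[symmetric] norm_prod_def)
  also have "\<dots> \<le> sqrt ((a * (s - s2) + a' * (q - q2))\<^sup>2 + (a' * (s - s2) - a * (q - q2))\<^sup>2)"
  proof -
    have "\<bar>max 0 u - max 0 v\<bar> \<le> \<bar>u - v\<bar>" for u v :: real by (auto simp: max_def)
    moreover have "a' * s - a * q - (a' * s2 - a * q2) = a' * (s - s2) - a * (q - q2)"
      by (simp add: algebra_simps)
    ultimately have "(?x - ?x2)\<^sup>2 \<le> (a' * (s - s2) - a * (q - q2))\<^sup>2"
      by (metis abs_le_square_iff)
    moreover have "?y - ?y2 = a * (s - s2) + a' * (q - q2)" by (simp add: algebra_simps)
    ultimately show ?thesis by (simp only: real_sqrt_le_iff add_le_cancel_left)
  qed
  also have "\<dots> = sqrt ((s - s2)\<^sup>2 + (q - q2)\<^sup>2)" by (simp only: cone_rotation)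
  also have "\<dots> \<le> \<bar>s - s2\<bar> + \<bar>q - q2\<bar>" by (rule sqrt_sum_squares_le_sum_abs)
  finally show ?thesis .
qed

lemma cone_support_upper:
  assumes "0 \<le> s" "0 \<le> q" "0 \<le> \<sigma>" "0 \<le> \<rho>" "a * \<rho> \<le> a' * \<sigma>"
  shows "\<sigma> * s + \<rho> * q \<le> sqrt (\<sigma>\<^sup>2 + \<rho>\<^sup>2) * cone_support a s q"
proof (cases "a' * s \<ge> a * q")
  case True
  have "(\<sigma> * s + \<rho> * q)\<^sup>2 + (\<sigma> * q - \<rho> * s)\<^sup>2 = (\<sigma>\<^sup>2 + \<rho>\<^sup>2) * (s\<^sup>2 + q\<^sup>2)"
    by (simp add: power2_eq_square algebra_simps)
  then have "(\<sigma> * s + \<rho> * q)\<^sup>2 \<le> (\<sigma>\<^sup>2 + \<rho>\<^sup>2) * (s\<^sup>2 + q\<^sup>2)"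
    by (metis le_add_same_cancel1 zero_le_power2)
  then show ?thesis using True by (simp add: cone_support_right real_le_rsqrt flip: real_sqrt_mult)
next
  case False
  define x y where "x = a' * \<sigma> - a * \<rho>" and "y = a * \<sigma> + a' * \<rho>"
  define X Y where "X = a' * s - a * q" and "Y = a * s + a' * q"
  have nn: "0 \<le> Y" using a assms cos_sin_props by (simp add: Y_def)
  have xX: "x * X \<le> 0" using False assms(5) by (simp add: x_def X_def mult_nonneg_nonpos)
  have "x * X + y * Y = (a\<^sup>2 + a'\<^sup>2) * (\<sigma> * s + \<rho> * q)"
    by (simp add: x_def y_def X_def Y_def power2_eq_square algebra_simps)
  then have "\<sigma> * s + \<rho> * q \<le> y * Y" using xX by (simp add: cos_sin_props)
  also have "y\<^sup>2 + x\<^sup>2 = \<sigma>\<^sup>2 + \<rho>\<^sup>2" unfolding x_def y_def by (rule cone_rotation)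
  then have "y\<^sup>2 \<le> \<sigma>\<^sup>2 + \<rho>\<^sup>2" by (metis le_add_same_cancel1 zero_le_power2)
  then have "y \<le> sqrt (\<sigma>\<^sup>2 + \<rho>\<^sup>2)" by (rule real_le_rsqrt)
  then have "y * Y \<le> sqrt (\<sigma>\<^sup>2 + \<rho>\<^sup>2) * Y" using nn by (rule mult_right_mono)
  finally show ?thesis using False assms by (simp add: cone_support_left Y_def)
qed

text \<open>Write \<open>a = cos \<theta>\<close> and \<open>t = cos \<tau>\<close>. Outside the
  cone the support value of a unit vector is the cosine of its angle to the cone, so being at most
  \<open>t\<close> means that the angle to the range is at least \<open>\<theta> + \<tau>\<close>.
  The cosine of that sum is \<open>\<mu>\<close>, and \<open>m_fun a t\<close> is its
  square.\<close>

lemma cone_support_middle: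
  assumes t: "0 \<le> t" "a' \<le> t" "t < 1" and b: "0 \<le> b" "b \<le> 1"
  shows "cone_support a (sqrt b) (sqrt (1 - b)) \<le> t \<longleftrightarrow> b \<le> m_fun a t"
proof -
  define t' \<sigma> \<rho> where "t' = sqrt (1 - t\<^sup>2)" and "\<sigma> = sqrt b" and "\<rho> = sqrt (1 - b)"
  have tt: "t\<^sup>2 + t'\<^sup>2 = 1" "0 \<le> t'" using t by (auto simp: t'_def abs_square_le_1)
  have sr: "\<sigma>\<^sup>2 + \<rho>\<^sup>2 = 1" "0 \<le> \<sigma>" "0 \<le> \<rho>" "b = \<sigma>\<^sup>2" using b by (auto simp: \<sigma>_def \<rho>_def)
  define x y where "x = a' * \<sigma> - a * \<rho>" and "y = a * \<sigma> + a' * \<rho>"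
  have xy: "y\<^sup>2 + x\<^sup>2 = 1" using cone_rotation[of \<sigma> \<rho>] sr by (simp add: x_def y_def)
  have y0: "0 \<le> y" using a cos_sin_props sr by (simp add: y_def)
  have \<sigma>: "\<sigma> = a * y + a' * x"
  proof -
    have "a * y + a' * x = (a\<^sup>2 + a'\<^sup>2) * \<sigma>" by (simp add: x_def y_def power2_eq_square algebra_simps)
    then show ?thesis by (simp add: cos_sin_props)
  qed
  \<comment> \<open>This says \<open>\<theta> + \<tau> \<le> pi / 2\<close>. It makes
    \<open>\<mu>\<close> nonnegative, so that \<open>\<sigma> \<le> \<mu>\<close> may be squared
    without loss.\<close>
  have t'_le: "t' \<le> a"
  proof -
    have "t'\<^sup>2 \<le> a\<^sup>2" using tt(1) cos_sin_props power_mono[OF t(2) cos_sin_props(1), of 2] by linarith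
    then show ?thesis using a(1) by (rule power2_le_imp_le)
  qed
  define \<mu> where "\<mu> = a * t - a' * t'"
  have \<mu>0: "0 \<le> \<mu>"
    using mult_mono[OF t'_le t(2) a(1) cos_sin_props(1)] by (simp add: \<mu>_def mult.commute)
  have m: "m_fun a t = \<mu>\<^sup>2"
    by (simp add: m_fun_def \<mu>_def a'_def t'_def real_sqrt_mult)
  have "cone_support a \<sigma> \<rho> \<le> t \<longleftrightarrow> \<sigma> \<le> \<mu>"
  proof
    assume *: "cone_support a \<sigma> \<rho> \<le> t"
    have "x \<le> 0"
    proof (rule ccontr)
      assume "\<not> x \<le> 0"
      then have "cone_support a \<sigma> \<rho> = 1" using sr by (subst cone_support_right) (auto simp: x_def)
      then show False using * t by simp
    qed
    then have "cone_support a \<sigma> \<rho> = y" using sr by (subst cone_support_left) (auto simp: x_def y_def)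
    then have yt: "y \<le> t" using * by simp
    then have "y\<^sup>2 \<le> t\<^sup>2" using y0 by (intro power_mono)
    then have "t'\<^sup>2 \<le> (- x)\<^sup>2" using xy tt by simp
    then have "t' \<le> - x" by (rule power2_le_imp_le) (use \<open>x \<le> 0\<close> in simp)
    then have "a' * x \<le> a' * (- t')" using cos_sin_props by (intro mult_left_mono) auto
    moreover have "a * y \<le> a * t" using yt a by (intro mult_left_mono)
    ultimately show "\<sigma> \<le> \<mu>" by (simp add: \<sigma> \<mu>_def)
  next
    assume *: "\<sigma> \<le> \<mu>"
    \<comment> \<open>The sine belonging to the cosine \<open>\<mu>\<close>;
      \<open>\<sigma> \<le> \<mu>\<close> turns into \<open>\<nu> \<le> \<rho>\<close>, and
      transforming back bounds \<open>x\<close> by \<open>- t'\<close>.\<close>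
    define \<nu> where "\<nu> = a' * t + a * t'"
    have "\<mu>\<^sup>2 + \<nu>\<^sup>2 = (a\<^sup>2 + a'\<^sup>2) * (t\<^sup>2 + t'\<^sup>2)"
      by (simp add: \<mu>_def \<nu>_def power2_eq_square algebra_simps)
    then have \<nu>: "\<mu>\<^sup>2 + \<nu>\<^sup>2 = 1" by (simp add: cos_sin_props tt)
    have "\<sigma>\<^sup>2 \<le> \<mu>\<^sup>2" using * sr(2) by (rule power_mono)
    moreover have "\<nu>\<^sup>2 = 1 - \<mu>\<^sup>2" "\<rho>\<^sup>2 = 1 - \<sigma>\<^sup>2" using \<nu> sr(1) by simp_all
    ultimately have "\<nu>\<^sup>2 \<le> \<rho>\<^sup>2" by simp
    then have \<rho>: "\<nu> \<le> \<rho>" using sr(3) by (rule power2_le_imp_le)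
    have "x \<le> a' * \<mu> - a * \<nu>"
      unfolding x_def using * \<rho> a cos_sin_props by (intro diff_mono mult_left_mono) auto
    also have "\<dots> = - ((a\<^sup>2 + a'\<^sup>2) * t')" by (simp add: \<mu>_def \<nu>_def power2_eq_square algebra_simps)
    finally have x: "x \<le> - t'" by (simp add: cos_sin_props)
    then have "t'\<^sup>2 \<le> (- x)\<^sup>2" using tt by (intro power_mono) auto
    then have "y\<^sup>2 \<le> t\<^sup>2" using xy tt by simp
    then have "y \<le> t" using t(1) by (rule power2_le_imp_le)
    moreover have "cone_support a \<sigma> \<rho> = y"
      using sr x tt by (subst cone_support_left) (auto simp: x_def y_def)
    ultimately show "cone_support a \<sigma> \<rho> \<le> t" by simp
  qed
  also have "\<sigma> \<le> \<mu> \<longleftrightarrow> b \<le> m_fun a t"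
    using sr \<mu>0 unfolding m by (simp add: abs_le_square_iff[symmetric])
  finally show ?thesis unfolding \<sigma>_def \<rho>_def .
qed

text \<open>No direction is farther from the cone than one orthogonal to the range, the case
  \<open>b = 0\<close>, whose angle to the boundary has cosine \<open>a'\<close>.\<close>

lemma cone_support_far:
  assumes "0 \<le> b" "b \<le> 1"
  shows "a' \<le> cone_support a (sqrt b) (sqrt (1 - b))"
proof -
  define \<sigma> \<rho> where "\<sigma> = sqrt b" and "\<rho> = sqrt (1 - b)"
  have sr: "\<sigma>\<^sup>2 + \<rho>\<^sup>2 = 1" "0 \<le> \<sigma>" "0 \<le> \<rho>" using assms by (auto simp: \<sigma>_def \<rho>_def)
  show ?thesis
  proof (cases "a' * \<sigma> \<ge> a * \<rho>")
    case True
    have "a'\<^sup>2 \<le> 1\<^sup>2" using cos_sin_props by (metis le_add_same_cancel2 one_power2 zero_le_power2)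
    then have "a' \<le> 1" by (rule power2_le_imp_le) simp
    then show ?thesis
      using True sr cone_support_right unfolding \<sigma>_def \<rho>_def by simp
  next
    case False
    \<comment> \<open>\<open>2 * k\<close> is the cross term of
      \<open>(a * \<sigma> + a' * \<rho>)\<^sup>2\<close>. Lying outside the cone gives
      \<open>(a' * \<sigma>)\<^sup>2 \<le> k\<close>, which supplies the \<open>\<sigma>\<close>
      part of \<open>a'\<^sup>2 * (\<sigma>\<^sup>2 + \<rho>\<^sup>2)\<close>.\<close>
    define k where "k = a' * \<sigma> * (a * \<rho>)"
    have "a' * \<sigma> * (a' * \<sigma>) \<le> k"
      unfolding k_def using False sr cos_sin_props by (intro mult_left_mono) auto
    moreover have "0 \<le> k" using a cos_sin_props sr by (simp add: k_def)
    moreover have "0 \<le> 2 * k - a' * \<sigma> * (a' * \<sigma>)" using calculation by linarith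
    moreover have "(a * \<sigma> + a' * \<rho>)\<^sup>2 = a'\<^sup>2 * (\<sigma>\<^sup>2 + \<rho>\<^sup>2) + (a * \<sigma>)\<^sup>2 + (2 * k - a' * \<sigma> * (a' * \<sigma>))"
      by (simp add: k_def power2_eq_square algebra_simps)
    moreover have "0 \<le> (a * \<sigma>)\<^sup>2" by simp
    ultimately have "a'\<^sup>2 * (\<sigma>\<^sup>2 + \<rho>\<^sup>2) \<le> (a * \<sigma> + a' * \<rho>)\<^sup>2"
      by simp
    then have "a'\<^sup>2 \<le> (a * \<sigma> + a' * \<rho>)\<^sup>2" unfolding sr by simp
    then have "a' \<le> a * \<sigma> + a' * \<rho>" by (rule power2_le_imp_le) (use a cos_sin_props sr in simp)
    then show ?thesis using False sr cone_support_left[of \<sigma> \<rho>] unfolding \<sigma>_def \<rho>_def by simp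
  qed
qed

end

subsection \<open>The distribution of the support function\<close>

lemma cone_support_measurable [measurable]:
  assumes [measurable]: "f \<in> borel_measurable M" "g \<in> borel_measurable M"
  shows "(\<lambda>x. cone_support a (f x) (g x)) \<in> borel_measurable M"
  unfolding cone_support_def by measurable

lemma beta_distribution_eq: "b \<noteq> 0 \<Longrightarrow> beta_distribution a b = density lborel (\<lambda>t. ennreal (beta_density a b t))"
  by (simp add: beta_distribution_def beta_density_def)

lemma real_distribution_beta:
  assumes "0 < a" "0 \<le> b"
  shows "real_distribution (beta_distribution a b)"
proof (cases "b = 0")
  case True
  then show ?thesis
    by (simp add: beta_distribution_def real_distribution_def real_distribution_axioms_def prob_space_return)
next
  case False
  then have "prob_space (beta_distribution a b)"
    using assms nn_integral_beta_density[of a b]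
    by (intro prob_spaceI) (simp add: beta_distribution_eq emeasure_density)
  then show ?thesis
    using False by (simp add: beta_distribution_eq real_distribution_def real_distribution_axioms_def)
qed

text \<open>Both terms of the difference lie in \<open>[0, 1)\<close>. For \<open>r = p\<close>,
  where \<open>H\<close> is the unit step at 1, this makes the integral in \<open>G_cdf\<close>
  vanish.\<close>

lemma m_fun_less_1:
  assumes "0 \<le> a" "a \<le> 1" "0 < t" "t < 1"
  shows "m_fun a t < 1"
proof -
  have "sqrt ((1 - a\<^sup>2) * (1 - t\<^sup>2)) < 1"
  proof -
    have "(1 - a\<^sup>2) * (1 - t\<^sup>2) \<le> 1 * (1 - t\<^sup>2)"
      using assms by (intro mult_right_mono) (auto simp: abs_square_le_1)
    also have "\<dots> < 1" using assms by simp
    finally show ?thesis by simp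
  qed
  moreover have "0 \<le> sqrt ((1 - a\<^sup>2) * (1 - t\<^sup>2))"
    using assms by (simp add: abs_square_le_1)
  moreover have "0 \<le> a * t" "a * t < 1"
    using assms mult_left_le_one_le[of t a] by (simp, linarith)
  ultimately have "\<bar>a * t - sqrt ((1 - a\<^sup>2) * (1 - t\<^sup>2))\<bar> < 1" by linarith
  then show ?thesis by (simp add: m_fun_def abs_square_less_1)
qed

text \<open>The computation uses the nonnegative integrals \<open>I1\<close> and \<open>I2\<close>;
  their sum is a probability, hence finite, which allows the return to real numbers. The case
  \<open>r = p\<close> is separate because the beta law is then a point mass without
  density.\<close>

lemma measure_cone_support_eq_G_cdf:
  fixes P :: "real ^ 'p ^ 'p"
  assumes P: "orth_proj (real r) P" and r: "0 < r" "r \<le> CARD('p)"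
    and a: "0 \<le> a" "a \<le> 1" and c: "0 < c"
  shows "measure std_normal_vec {u. cone_support a (norm (P *v u)) (norm (u - P *v u)) \<le> c} =
    G_cdf CARD('p) r a (c\<^sup>2)"
proof -
  define g where "g = c\<^sup>2"
  have g: "0 < g" "sqrt g = c" using c by (auto simp: g_def)
  define ub where "ub = (if a = 1 then \<infinity> else ereal (g / (1 - a\<^sup>2)))"
  define \<beta> where "\<beta> = beta_distribution (real r / 2) (real (CARD('p) - r) / 2)"
  define H where "H w = cdf \<beta> (m_fun a (sqrt (g / w)))" for w
  define \<kappa> where "\<kappa> = chi_square_density CARD('p)"
  interpret \<beta>: real_distribution \<beta>
    unfolding \<beta>_def using r by (intro real_distribution_beta) auto
  interpret N: prob_space "std_normal_vec :: (real ^ 'p) measure" by (rule prob_space_std_normal_vec)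
  have [measurable]: "H \<in> borel_measurable borel"
  proof -
    have [measurable]: "cdf \<beta> \<in> borel_measurable borel"
      by (intro borel_measurable_mono monoI \<beta>.cdf_nondecreasing)
    show ?thesis unfolding H_def m_fun_def by measurable
  qed
  have [measurable]: "\<kappa> \<in> borel_measurable borel" unfolding \<kappa>_def by measurable
  have H0: "0 \<le> H w" for w unfolding H_def by (rule \<beta>.cdf_nonneg)
  have \<kappa>0: "0 \<le> \<kappa> w" for w unfolding \<kappa>_def by (intro chi_square_density_nonneg) simp
  have a1: "a \<noteq> 1 \<Longrightarrow> 0 < 1 - a\<^sup>2"
    using a by (metis abs_of_nonneg abs_square_less_1 diff_gt_0_iff_gt order_le_imp_less_or_eq)
  have g_ub: "ereal g \<le> ub"
    using a1 g by (auto simp: ub_def divide_simps)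
  let ?E = "{u :: real ^ 'p. cone_support a (norm (P *v u)) (norm (u - P *v u)) \<le> c}"
  define I1 I2 where "I1 = (\<integral>\<^sup>+w. ennreal (\<kappa> w) * indicator {..g} w \<partial>lborel)"
    and "I2 = (\<integral>\<^sup>+w. ennreal (indicator (einterval g ub) w * (H w * \<kappa> w)) \<partial>lborel)"
  have G: "G_cdf CARD('p) r a g = enn2real I1 + enn2real I2"
  proof -
    have "cdf (chi_square_distribution CARD('p)) g = enn2real I1"
      by (simp add: cdf_def measure_def chi_square_distribution_def emeasure_density I1_def \<kappa>_def)
    \<comment> \<open>For a nonnegative measurable integrand the integral equals
      \<open>enn2real\<close> of the nonnegative integral, whether or not the latter is finite, so
      integrability need not be known yet.\<close>
    moreover have "(LBINT w = ereal g .. ub. H w * \<kappa> w) = enn2real I2"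
      using g_ub H0 \<kappa>0 unfolding I2_def
      by (simp add: interval_lebesgue_integral_def set_lebesgue_integral_def)
         (subst integral_eq_nn_integral; simp add: indicator_def)
    ultimately show ?thesis unfolding G_cdf_def \<beta>_def[symmetric] H_def \<kappa>_def ub_def by simp
  qed
  have mE [measurable]: "?E \<in> sets borel"
  proof -
    have [measurable]: "(\<lambda>u. P *v u) \<in> borel_measurable borel"
      by (intro borel_measurable_continuous_onI linear_continuous_on) simp
    show ?thesis by measurable
  qed
  have E_ind: "emeasure std_normal_vec ?E = (\<integral>\<^sup>+u. indicator ?E u \<partial>std_normal_vec)"
    using mE by simp
  have "emeasure std_normal_vec ?E = I1 + I2"
  proof (cases "r = CARD('p)")
    case True
    have Pu: "P *v u = u" for u using P unfolding True by (rule orth_proj_full)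
    \<comment> \<open>\<open>P\<close> is the identity, so every point lies in the cone and the
      event is a ball.\<close>
    have "cone_support a s 0 = s" if "0 \<le> s" for s
      using cone_support_right[OF a refl, of 0 s] that a by (simp add: abs_square_le_1)
    then have E_eq: "?E = {u. (norm u)\<^sup>2 \<le> g}"
      by (auto simp: Pu g(2)[symmetric] real_le_rsqrt) (metis g(2) norm_ge_zero real_sqrt_le_iff real_sqrt_abs abs_norm_cancel)
    have "emeasure std_normal_vec ?E = (\<integral>\<^sup>+u. indicator {..g} ((norm (u :: real ^ 'p))\<^sup>2) \<partial>std_normal_vec)"
      unfolding E_ind unfolding E_eq by (intro nn_integral_cong) (simp add: indicator_def)
    also have "\<dots> = I1"
      by (subst nn_integral_std_normal_norm) (auto simp: I1_def \<kappa>_def mult.commute)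
    finally have "emeasure std_normal_vec ?E = I1" .
    moreover have "I2 = 0"
    proof -
      have "H w = 0" if "w \<in> einterval g ub" for w
      proof -
        have "g < w" using that by (simp add: einterval_def)
        then have "m_fun a (sqrt (g / w)) < 1"
          using g a by (intro m_fun_less_1) auto
        then show ?thesis unfolding H_def \<beta>_def by (simp add: True beta_distribution_def cdf_def measure_return)
      qed
      then have "indicator (einterval g ub) w * (H w * \<kappa> w) = 0" for w by (simp add: indicator_def)
      then show ?thesis unfolding I2_def by (simp only:) simp
    qed
    ultimately show ?thesis by simp
  next
    case False
    then have r': "r < CARD('p)" using r by simp
    define f :: "real \<Rightarrow> real \<Rightarrow> ennreal" where "f x y = indicator {..c} (cone_support a (sqrt x) (sqrt y))" for x y
    define B where "B = beta_density (r / 2) (real (CARD('p) - r) / 2)"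
    have [measurable]: "B \<in> borel_measurable borel" unfolding B_def by measurable
    have \<beta>_eq: "\<beta> = density lborel (\<lambda>t. ennreal (B t))"
      unfolding \<beta>_def B_def using r' by (intro beta_distribution_eq) simp
    have "emeasure std_normal_vec ?E = (\<integral>\<^sup>+u. f ((norm (P *v u))\<^sup>2) ((norm (u - P *v u))\<^sup>2) \<partial>std_normal_vec)"
      unfolding E_ind by (intro nn_integral_cong) (simp add: f_def indicator_def)
    also have "\<dots> = (\<integral>\<^sup>+w. ennreal (\<kappa> w) * (\<integral>\<^sup>+b. f (w * b) (w * (1 - b)) * ennreal (B b) \<partial>lborel) \<partial>lborel)"
      unfolding \<kappa>_def B_def f_def by (rule nn_integral_std_normal_proj[OF P r(1) r']) measurable
    also have "\<dots> = (\<integral>\<^sup>+w. ennreal (\<kappa> w) * indicator {..g} w + ennreal (indicator (einterval g ub) w * (H w * \<kappa> w)) \<partial>lborel)"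
    proof (rule nn_integral_cong_AE)
      \<comment> \<open>The endpoint of the open interval \<open>einterval g ub\<close> is outside
        the three cases below, but a single point is negligible. For \<open>a = 1\<close> the
        quotient is 0 by the convention on division, so only \<open>w = 0\<close> is
        excluded.\<close>
      have "AE w in lborel. w \<noteq> g / (1 - a\<^sup>2)" by (rule AE_lborel_singleton)
      then show "AE w in lborel. ennreal (\<kappa> w) * (\<integral>\<^sup>+b. f (w * b) (w * (1 - b)) * ennreal (B b) \<partial>lborel) =
          ennreal (\<kappa> w) * indicator {..g} w + ennreal (indicator (einterval g ub) w * (H w * \<kappa> w))"
      proof eventually_elim
        fix w assume w_ub: "w \<noteq> g / (1 - a\<^sup>2)"
        show "ennreal (\<kappa> w) * (\<integral>\<^sup>+b. f (w * b) (w * (1 - b)) * ennreal (B b) \<partial>lborel) =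
          ennreal (\<kappa> w) * indicator {..g} w + ennreal (indicator (einterval g ub) w * (H w * \<kappa> w))"
        proof (cases "0 < w")
          case False
          then have "\<kappa> w = 0" by (simp add: \<kappa>_def chi_square_density_def)
          then show ?thesis by simp
        next
          case True
          \<comment> \<open>By homogeneity \<open>t = c / sqrt w\<close> is the bound for the unit
            vector with components \<open>sqrt b\<close> and \<open>sqrt (1 - b)\<close>.\<close>
          define t where "t = sqrt (g / w)"
          define J where "J = (\<integral>\<^sup>+b. f (w * b) (w * (1 - b)) * ennreal (B b) \<partial>lborel)"
          have t0: "0 < t" using True g by (simp add: t_def)
          have J: "J = (\<integral>\<^sup>+b. indicator {b. cone_support a (sqrt b) (sqrt (1 - b)) \<le> t} b * ennreal (B b) \<partial>lborel)"
            unfolding J_def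
          proof (rule nn_integral_cong)
            fix b
            show "f (w * b) (w * (1 - b)) * ennreal (B b) =
                indicator {b. cone_support a (sqrt b) (sqrt (1 - b)) \<le> t} b * ennreal (B b)"
            proof (cases "0 < b \<and> b < 1")
              case b: True
              have "cone_support a (sqrt (w * b)) (sqrt (w * (1 - b))) =
                  sqrt w * cone_support a (sqrt b) (sqrt (1 - b))"
                using True cone_support_scale[OF a refl, of "sqrt w"] by (simp add: real_sqrt_mult)
              moreover have "t = c / sqrt w" by (simp add: t_def real_sqrt_divide g(2))
              ultimately have "cone_support a (sqrt (w * b)) (sqrt (w * (1 - b))) \<le> c \<longleftrightarrow>
                  cone_support a (sqrt b) (sqrt (1 - b)) \<le> t"
                using True by (simp add: pos_le_divide_eq mult.commute)
              then show ?thesis by (simp add: f_def indicator_def)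
            qed (auto simp: B_def beta_density_def)
          qed
          have "ereal w \<noteq> ub" using w_ub by (auto simp: ub_def)
          \<comment> \<open>In terms of \<open>t\<close> the cases are \<open>1 \<le> t\<close>,
            \<open>sqrt (1 - a\<^sup>2) \<le> t < 1\<close> and
            \<open>t < sqrt (1 - a\<^sup>2)\<close>, settled by \<open>cone_support_le\<close>,
            \<open>cone_support_middle\<close> and \<open>cone_support_far\<close>.\<close>
          then consider "w \<le> g" | "g < w" "ereal w < ub" | "g < w" "ub < ereal w"
            by (metis linorder_neqE not_le)
          then show ?thesis
          proof cases
            case 1
            then have "1 \<le> t" using True by (simp add: t_def)
            have "J = (\<integral>\<^sup>+b. ennreal (B b) \<partial>lborel)"
              unfolding J
            proof (rule nn_integral_cong)
              fix b
              have "cone_support a (sqrt b) (sqrt (1 - b)) \<le> t" if "0 < b \<and> b < 1"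
                using cone_support_le[OF a refl, of "sqrt b" "sqrt (1 - b)"] that \<open>1 \<le> t\<close> by simp
              then show "indicator {b. cone_support a (sqrt b) (sqrt (1 - b)) \<le> t} b * ennreal (B b) = ennreal (B b)"
                by (cases "0 < b \<and> b < 1") (auto simp: B_def beta_density_def)
            qed
            also have "\<dots> = 1" unfolding B_def using r r' by (intro nn_integral_beta_density) auto
            finally show ?thesis
              using 1 unfolding J_def by (simp add: einterval_def)
          next
            case 2
            have "t < 1" using 2(1) True g by (simp add: t_def)
            have "1 - a\<^sup>2 \<le> g / w"
            proof (cases "a = 1")
              case False
              then have "w < g / (1 - a\<^sup>2)" using 2 by (simp add: ub_def)
              then show ?thesis using a1[OF False] True by (simp add: field_simps)
            qed (use True g in simp)
            then have "sqrt (1 - a\<^sup>2) \<le> t" by (simp add: t_def)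
            have "J = (\<integral>\<^sup>+b. ennreal (B b) * indicator {..m_fun a t} b \<partial>lborel)"
              unfolding J
            proof (rule nn_integral_cong)
              fix b
              have "cone_support a (sqrt b) (sqrt (1 - b)) \<le> t \<longleftrightarrow> b \<le> m_fun a t" if "0 < b \<and> b < 1"
                using that t0 \<open>t < 1\<close> \<open>sqrt (1 - a\<^sup>2) \<le> t\<close> by (intro cone_support_middle[OF a refl]) auto
              then show "indicator {b. cone_support a (sqrt b) (sqrt (1 - b)) \<le> t} b * ennreal (B b) =
                  ennreal (B b) * indicator {..m_fun a t} b"
                by (cases "0 < b \<and> b < 1") (auto simp: B_def beta_density_def indicator_def)
            qed
            also have "\<dots> = emeasure \<beta> {..m_fun a t}"
              unfolding \<beta>_eq by (subst emeasure_density) auto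
            also have "\<dots> = ennreal (H w)"
              by (simp add: H_def cdf_def t_def \<beta>.emeasure_eq_measure)
            finally show ?thesis
              using 2 H0 \<kappa>0 unfolding J_def by (simp add: einterval_def ennreal_mult mult.commute)
          next
            case 3
            then have "a \<noteq> 1" by (auto simp: ub_def)
            then have "g / (1 - a\<^sup>2) < w" using 3 by (simp add: ub_def)
            then have "g / w < 1 - a\<^sup>2" using a1[OF \<open>a \<noteq> 1\<close>] True by (simp add: field_simps)
            then have t: "t < sqrt (1 - a\<^sup>2)" by (simp add: t_def)
            have "J = (\<integral>\<^sup>+b. 0 \<partial>(lborel :: real measure))"
              unfolding J
            proof (rule nn_integral_cong)
              fix b
              have "\<not> cone_support a (sqrt b) (sqrt (1 - b)) \<le> t" if "0 < b \<and> b < 1"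
                using that t cone_support_far[OF a refl, of b] by auto
              then show "indicator {b. cone_support a (sqrt b) (sqrt (1 - b)) \<le> t} b * ennreal (B b) = 0"
                by (cases "0 < b \<and> b < 1") (auto simp: B_def beta_density_def indicator_def)
            qed
            then show ?thesis
              using 3 unfolding J_def by (simp add: einterval_def)
          qed
        qed
      qed
    qed
    also have "\<dots> = I1 + I2" unfolding I1_def I2_def by (rule nn_integral_add) measurable
    finally show ?thesis .
  qed
  moreover from this have "I1 \<noteq> \<infinity>" "I2 \<noteq> \<infinity>"
    using N.emeasure_finite[of ?E] by (auto simp: top_unique)
  ultimately have "measure std_normal_vec ?E = enn2real I1 + enn2real I2"
    by (simp add: measure_def enn2real_plus less_top)
  then show ?thesis using G unfolding g_def by simp
qed

section \<open>From the band condition to the support function\<close>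

lemma inner_proj_split:
  assumes P: "orth_proj r P"
  shows "y \<bullet> u = (P *v y) \<bullet> (P *v u) + (y - P *v y) \<bullet> (u - P *v u)"
proof -
  have "y \<bullet> u = (P *v y + (y - P *v y)) \<bullet> (P *v u + (u - P *v u))" by simp
  also have "\<dots> = (P *v y) \<bullet> (P *v u) + (y - P *v y) \<bullet> (u - P *v u)"
    using orth_proj_inner_complement[OF P, of y u] orth_proj_inner_complement[OF P, of u y]
    by (simp only: inner_add_left inner_add_right) (simp add: inner_commute)
  finally show ?thesis .
qed

text \<open>From left to right, the hypothesis is tested on a maximizing direction, which is
  \<open>u\<close> itself inside the cone. From right to left, Cauchy-Schwarz is applied in the
  range and in its complement separately, followed by \<open>cone_support_upper\<close>.\<close>

lemma cone_band_iff:
  fixes P :: "real ^ 'p ^ 'p"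
  assumes P: "orth_proj r P" and r: "0 < r" and a: "0 \<le> a" "a \<le> 1" and c: "0 \<le> c"
  shows "(\<forall>y. a * norm y \<le> norm (P *v y) \<longrightarrow> \<bar>y \<bullet> u\<bar> \<le> c * norm y) \<longleftrightarrow>
    cone_support a (norm (P *v u)) (norm (u - P *v u)) \<le> c"
proof
  define a' where "a' = sqrt (1 - a\<^sup>2)"
  note a' = cos_sin_props[OF a a'_def]
  define s q where "s = norm (P *v u)" and "q = norm (u - P *v u)"
  have sq: "0 \<le> s" "0 \<le> q" "s\<^sup>2 + q\<^sup>2 = (norm u)\<^sup>2"
    using orth_proj_norm[OF P, of u] by (auto simp: s_def q_def)
  assume *: "\<forall>y. a * norm y \<le> norm (P *v y) \<longrightarrow> \<bar>y \<bullet> u\<bar> \<le> c * norm y"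
  show "cone_support a (norm (P *v u)) (norm (u - P *v u)) \<le> c"
  proof (cases "a' * s \<ge> a * q")
    case True
    then have cs: "cone_support a s q = norm u"
      using cone_support_right[OF a a'_def, of q s] sq by simp
    have "(a * norm u)\<^sup>2 \<le> s\<^sup>2"
    proof -
      have "(a * q)\<^sup>2 \<le> (a' * s)\<^sup>2" using True a sq by (intro power_mono) auto
      then have "a\<^sup>2 * (s\<^sup>2 + q\<^sup>2) \<le> (a\<^sup>2 + a'\<^sup>2) * s\<^sup>2"
        by (simp add: power_mult_distrib algebra_simps)
      then show ?thesis using a' sq by (simp add: power_mult_distrib)
    qed
    then have "a * norm u \<le> s" using sq(1) by (rule power2_le_imp_le)
    then have "\<bar>u \<bullet> u\<bar> \<le> c * norm u" using * unfolding s_def by blast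
    then have "norm u * norm u \<le> c * norm u" by (simp add: dot_square_norm power2_eq_square)
    then have "norm u \<le> c" using c by (cases "norm u = 0") auto
    then show ?thesis using cs by (simp add: s_def q_def)
  next
    case False
    then have q0: "0 < q" using sq a a' by (metis mult_zero_right mult_nonneg_nonneg order_le_less)
    \<comment> \<open>The direction of \<open>P *v u\<close>; if that vector is 0, any unit vector
      of the range serves, and a positive trace provides one.\<close>
    obtain e where e: "P *v e = e" "norm e = 1" "e \<bullet> (P *v u) = s"
    proof (cases "s = 0")
      case True
      have "P \<noteq> 0"
      proof
        assume "P = 0"
        then have "trace P = 0" by (simp add: trace_def)
        then show False using P r by (simp add: orth_proj_def)
      qed
      then obtain v where v: "P *v v \<noteq> 0" by (metis matrix_eq matrix_vector_mult_0)
      let ?e = "(1 / norm (P *v v)) *\<^sub>R (P *v v)"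
      have "P *v ?e = ?e" by (simp add: matrix_vector_mult_scaleR orth_proj_idem[OF P])
      moreover have "norm ?e = 1" using v by simp
      moreover have "?e \<bullet> (P *v u) = s" using True by (simp add: s_def)
      ultimately show thesis by (rule that)
    next
      case False
      let ?e = "(1 / s) *\<^sub>R (P *v u)"
      have "P *v ?e = ?e" by (simp add: matrix_vector_mult_scaleR orth_proj_idem[OF P])
      moreover have "norm ?e = 1" using False sq by (simp add: s_def)
      moreover have "?e \<bullet> (P *v u) = s" using False by (simp add: s_def dot_square_norm power2_eq_square)
      ultimately show thesis by (rule that)
    qed
    define d where "d = (1 / q) *\<^sub>R (u - P *v u)"
    have d: "P *v d = 0" "norm d = 1" "d \<bullet> (u - P *v u) = q"
      using q0 by (auto simp: d_def q_def matrix_vector_mult_scaleR matrix_vector_mult_diff_distrib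
          orth_proj_idem[OF P] dot_square_norm power2_eq_square)
    \<comment> \<open>The boundary direction of the cone nearest to \<open>u\<close>.\<close>
    define y where "y = a *\<^sub>R e + a' *\<^sub>R d"
    have Py: "P *v y = a *\<^sub>R e" "y - P *v y = a' *\<^sub>R d"
      by (auto simp: y_def matrix_vector_right_distrib matrix_vector_mult_scaleR e d)
    have "(norm y)\<^sup>2 = 1"
    proof -
      have "norm (P *v y) = a" unfolding Py(1) using a e by simp
      moreover have "norm (y - P *v y) = a'" unfolding Py(2) using a' d by simp
      ultimately show ?thesis using orth_proj_norm[OF P, of y] a' by simp
    qed
    then have ny: "norm y = 1" by (metis norm_ge_zero one_power2 power2_eq_iff_nonneg zero_le_one)
    have "a * norm y \<le> norm (P *v y)" using a by (simp add: ny Py e)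
    with * have "\<bar>y \<bullet> u\<bar> \<le> c * norm y" by blast
    moreover have "y \<bullet> u = a * s + a' * q"
    proof -
      have "(P *v y) \<bullet> (P *v u) = a * s" unfolding Py(1) by (simp add: e)
      moreover have "(y - P *v y) \<bullet> (u - P *v u) = a' * q" unfolding Py(2) inner_scaleR_left d ..
      ultimately show ?thesis by (simp add: inner_proj_split[OF P, of y u])
    qed
    ultimately have "a * s + a' * q \<le> c" by (simp add: ny)
    then show ?thesis
      using False sq cone_support_left[OF a a'_def, of s q] by (simp add: s_def q_def)
  qed
next
  define a' where "a' = sqrt (1 - a\<^sup>2)"
  note a' = cos_sin_props[OF a a'_def]
  define s q where "s = norm (P *v u)" and "q = norm (u - P *v u)"
  assume "cone_support a (norm (P *v u)) (norm (u - P *v u)) \<le> c"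
  then have cs: "cone_support a s q \<le> c" by (simp add: s_def q_def)
  show "\<forall>y. a * norm y \<le> norm (P *v y) \<longrightarrow> \<bar>y \<bullet> u\<bar> \<le> c * norm y"
  proof (intro allI impI)
    fix y assume y: "a * norm y \<le> norm (P *v y)"
    define \<sigma> \<rho> where "\<sigma> = norm (P *v y)" and "\<rho> = norm (y - P *v y)"
    have sr: "0 \<le> \<sigma>" "0 \<le> \<rho>" "\<sigma>\<^sup>2 + \<rho>\<^sup>2 = (norm y)\<^sup>2"
      using orth_proj_norm[OF P, of y] by (auto simp: \<sigma>_def \<rho>_def)
    have "(a * norm y)\<^sup>2 \<le> \<sigma>\<^sup>2" using y a unfolding \<sigma>_def by (intro power_mono) auto
    then have "a\<^sup>2 * (\<sigma>\<^sup>2 + \<rho>\<^sup>2) \<le> (a\<^sup>2 + a'\<^sup>2) * \<sigma>\<^sup>2" by (simp add: a' sr power_mult_distrib)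
    then have "(a * \<rho>)\<^sup>2 \<le> (a' * \<sigma>)\<^sup>2" by (simp add: power_mult_distrib algebra_simps)
    then have "a * \<rho> \<le> a' * \<sigma>" by (rule power2_le_imp_le) (use a' sr in simp)
    have "\<bar>y \<bullet> u\<bar> \<le> \<sigma> * s + \<rho> * q"
      unfolding inner_proj_split[OF P, of y u] \<sigma>_def \<rho>_def s_def q_def
      by (intro order_trans[OF abs_triangle_ineq] add_mono Cauchy_Schwarz_ineq2)
    also have "\<dots> \<le> sqrt (\<sigma>\<^sup>2 + \<rho>\<^sup>2) * cone_support a s q"
      using sr \<open>a * \<rho> \<le> a' * \<sigma>\<close> by (intro cone_support_upper[OF a a'_def]) (auto simp: s_def q_def)
    also have "\<dots> \<le> norm y * c" unfolding sr(3) using cs by (simp add: mult_left_mono)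
    finally show "\<bar>y \<bullet> u\<bar> \<le> c * norm y" by (simp add: mult.commute)
  qed
qed

subsection \<open>Square roots of positive definite matrices\<close>

text \<open>\<open>norm A\<close> is the Frobenius norm, and the bound is Cauchy-Schwarz in each
  row.\<close>

lemma norm_matrix_vector_mult_le:
  fixes A :: "real ^ 'n ^ 'm"
  shows "norm (A *v x) \<le> norm A * norm x"
proof -
  have "norm (A *v x) \<le> L2_set (\<lambda>i. norm (A $ i) * norm x) UNIV"
    unfolding norm_vec_def[of "A *v x"]
    by (intro L2_set_mono) (auto simp: matrix_vector_mul_component Cauchy_Schwarz_ineq2)
  then show ?thesis
    unfolding norm_vec_def[of A] by (simp add: L2_set_left_distrib)
qed

lemma sym_pos_def_invertible:
  fixes A :: "real ^ 'n ^ 'n"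
  assumes "sym_pos_def A"
  shows "A ** matrix_inv A = mat 1" "matrix_inv A ** A = mat 1"
proof -
  have "x = 0" if "A *v x = 0" for x
    using assms that unfolding sym_pos_def_def by (metis inner_zero_right less_irrefl)
  then have "invertible A"
    by (auto simp: invertible_left_inverse matrix_left_invertible_ker)
  then have "A ** matrix_inv A = mat 1 \<and> matrix_inv A ** A = mat 1"
    unfolding invertible_def matrix_inv_def by (rule someI_ex)
  then show "A ** matrix_inv A = mat 1" "matrix_inv A ** A = mat 1" by auto
qed

lemma sym_pos_def_transpose_inv:
  assumes "sym_pos_def (A :: real ^ 'n ^ 'n)"
  shows "transpose (matrix_inv A) = matrix_inv A"
proof -
  have "transpose (matrix_inv A) ** A = mat 1"
    using arg_cong[OF sym_pos_def_invertible(1)[OF assms], of transpose] assms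
    by (simp add: matrix_transpose_mul transpose_mat sym_pos_def_def)
  then show ?thesis
    by (metis matrix_mul_assoc matrix_mul_lid matrix_mul_rid sym_pos_def_invertible(1)[OF assms])
qed

lemma sym_pos_def_nonneg: "sym_pos_def A \<Longrightarrow> 0 \<le> v \<bullet> (A *v v)"
  by (cases "v = 0") (auto simp: sym_pos_def_def less_imp_le)

lemma sym_inner: "transpose A = A \<Longrightarrow> (A *v u) \<bullet> v = u \<bullet> (A *v (v :: real ^ 'n))"
  by (metis dot_lmul_matrix vector_transpose_matrix)

text \<open>With \<open>D = S - T\<close> one has \<open>S D + D T = 0\<close>, hence \<open>tr (D S D) + tr (D T D) = 0\<close>,
  where both traces are nonnegative.\<close>

lemma sym_pos_def_sqrt_unique:
  fixes S T :: "real ^ 'n ^ 'n"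
  assumes S: "sym_pos_def S" and T: "sym_pos_def T" and eq: "S ** S = T ** T"
  shows "S = T"
proof -
  define D where "D = S - T"
  have tD: "transpose D = D"
    using S T by (simp add: D_def sym_pos_def_def transpose_def vec_eq_iff)
  have "S ** D + D ** T = 0"
    using eq by (simp add: D_def matrix_eq matrix_vector_mult_add_rdistrib matrix_vector_mult_diff_rdistrib
        matrix_vector_mult_diff_distrib flip: matrix_vector_mul_assoc)
  then have "D ** (S ** D) + D ** (D ** T) = 0"
    by (simp flip: matrix_add_ldistrib)
  then have "trace (D ** (S ** D)) + trace (D ** (D ** T)) = 0"
    by (simp flip: trace_add) (simp add: trace_def)
  moreover have "trace (D ** (D ** T)) = trace (D ** (T ** D))"
    using trace_mul_sym[of D "D ** T"] by (simp add: matrix_mul_assoc)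
  moreover have tr: "trace (D ** (M ** D)) = (\<Sum>e\<in>Basis. (D *v e) \<bullet> (M *v (D *v e)))" for M
    by (simp add: trace_eq_sum_Basis sym_inner[OF tD] flip: matrix_vector_mul_assoc)
  ultimately have "(\<Sum>e\<in>Basis. (D *v e) \<bullet> (S *v (D *v e)) + (D *v e) \<bullet> (T *v (D *v e))) = 0"
    by (simp add: sum.distrib)
  then have "\<forall>e\<in>Basis. (D *v e) \<bullet> (S *v (D *v e)) + (D *v e) \<bullet> (T *v (D *v e)) = 0"
    by (subst (asm) sum_nonneg_eq_0_iff) (auto intro!: add_nonneg_nonneg sym_pos_def_nonneg S T)
  then have "D *v e = 0" if "e \<in> Basis" for e
    using that S sym_pos_def_nonneg[OF T, of "D *v e"] unfolding sym_pos_def_def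
    by (metis add_less_same_cancel2 add_pos_nonneg less_irrefl)
  then have "D *v v = 0" for v
    by (subst euclidean_representation[of v, symmetric])
      (simp add: linear_sum[OF matrix_vector_mul_linear] matrix_vector_mult_scaleR)
  then have "D = 0" by (simp add: matrix_eq)
  then show ?thesis by (simp add: D_def)
qed

text \<open>\<open>\<mu>\<close> is the minimum of the quadratic form on the unit sphere, attained
  by compactness and therefore positive.\<close>

lemma sym_pos_def_coercive:
  assumes "sym_pos_def (A :: real ^ 'n ^ 'n)"
  obtains \<mu> where "0 < \<mu>" "\<And>v. \<mu> * (norm v)\<^sup>2 \<le> v \<bullet> (A *v v)"
proof -
  have "\<exists>x\<in>sphere 0 1. \<forall>y\<in>sphere 0 1. x \<bullet> (A *v x) \<le> y \<bullet> (A *v y)"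
    by (intro continuous_attains_inf continuous_intros linear_continuous_on) auto
  then obtain x where x: "norm x = 1" "\<And>y. norm y = 1 \<Longrightarrow> x \<bullet> (A *v x) \<le> y \<bullet> (A *v y)"
    by auto
  have "x \<noteq> 0" using x(1) by auto
  then have "0 < x \<bullet> (A *v x)" using assms by (simp add: sym_pos_def_def)
  moreover have "(x \<bullet> (A *v x)) * (norm v)\<^sup>2 \<le> v \<bullet> (A *v v)" for v
  proof (cases "v = 0")
    case False
    have "x \<bullet> (A *v x) \<le> ((1 / norm v) *\<^sub>R v) \<bullet> (A *v ((1 / norm v) *\<^sub>R v))"
      using False by (intro x(2)) simp
    also have "\<dots> = (v \<bullet> (A *v v)) / (norm v)\<^sup>2"
      by (simp add: matrix_vector_mult_scaleR power2_eq_square)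
    finally show ?thesis using False by (simp add: field_simps)
  qed simp
  ultimately show thesis by (rule that)
qed

text \<open>After scaling, \<open>A = I - C\<close> with \<open>\<parallel>C\<parallel> < 1\<close>; then \<open>I - X\<close> is a square root of \<open>A\<close> for the fixed
  point \<open>X\<close> of the contraction \<open>X \<mapsto> (C + X\<^sup>2) / 2\<close>.\<close>

lemma sym_pos_def_sqrt_exists:
  fixes A :: "real ^ 'n ^ 'n"
  assumes A: "sym_pos_def A"
  shows "\<exists>S. sym_pos_def S \<and> S ** S = A"
proof -
  obtain \<mu> where \<mu>: "0 < \<mu>" "\<And>v. \<mu> * (norm v)\<^sup>2 \<le> v \<bullet> (A *v v)"
    using sym_pos_def_coercive[OF A] by blast
  \<comment> \<open>With \<open>c = I - A / \<kappa>\<close>, \<open>(norm (c v))\<^sup>2\<close> is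
    at most \<open>1 - 2 * \<mu> / \<kappa> + (norm A)\<^sup>2 / \<kappa>\<^sup>2\<close> times
    \<open>(norm v)\<^sup>2\<close>. The first summand of \<open>\<kappa>\<close> bounds the last
    term by \<open>\<mu> / \<kappa>\<close>, leaving \<open>1 - \<mu> / \<kappa>\<close>; the other
    two ensure \<open>\<mu> < \<kappa>\<close>.\<close>
  define \<kappa> where "\<kappa> = (norm A)\<^sup>2 / \<mu> + \<mu> + 1"
  have \<kappa>: "0 < \<kappa>" "\<mu> < \<kappa>" "(norm A)\<^sup>2 \<le> \<mu> * \<kappa>"
  proof -
    have "0 \<le> (norm A)\<^sup>2 / \<mu>" using \<mu>(1) by simp
    then show "0 < \<kappa>" "\<mu> < \<kappa>" unfolding \<kappa>_def using \<mu>(1) by linarith+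
    have "\<mu> * \<kappa> = (norm A)\<^sup>2 + (\<mu> * \<mu> + \<mu>)"
      using \<mu>(1) by (simp add: \<kappa>_def distrib_left)
    then show "(norm A)\<^sup>2 \<le> \<mu> * \<kappa>" using \<mu>(1) by simp
  qed
  define q where "q = sqrt (1 - \<mu> / \<kappa>)"
  have q: "0 \<le> q" "q < 1" "q\<^sup>2 = 1 - \<mu> / \<kappa>"
    using \<kappa> \<mu>(1) by (auto simp: q_def)
  define c where "c v = v - (1 / \<kappa>) *\<^sub>R (A *v v)" for v :: "real ^ 'n"
  have c_lin: "bounded_linear c"
    unfolding c_def by (intro bounded_linear_sub bounded_linear_ident bounded_linear_const_scaleR) simp
  have c_norm: "norm (c v) \<le> q * norm v" for v
  proof -
    have "(norm (A *v v))\<^sup>2 \<le> (norm A * norm v)\<^sup>2"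
      by (intro power_mono norm_matrix_vector_mult_le) simp
    also have "\<dots> \<le> \<mu> * \<kappa> * (norm v)\<^sup>2"
      unfolding power_mult_distrib by (intro mult_right_mono \<kappa>(3)) simp
    finally have Av: "(norm (A *v v))\<^sup>2 / \<kappa>\<^sup>2 \<le> \<mu> / \<kappa> * (norm v)\<^sup>2"
      using \<kappa>(1) by (simp add: field_simps power2_eq_square)
    have "(norm (c v))\<^sup>2 = (norm v)\<^sup>2 - 2 * (v \<bullet> (A *v v)) / \<kappa> + (norm (A *v v))\<^sup>2 / \<kappa>\<^sup>2"
      using dot_norm_neg[of v "(1 / \<kappa>) *\<^sub>R (A *v v)"] by (simp add: c_def power_divide field_simps)
    also have "\<dots> \<le> (norm v)\<^sup>2 - 2 * (\<mu> * (norm v)\<^sup>2) / \<kappa> + \<mu> / \<kappa> * (norm v)\<^sup>2"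
      using \<mu>(2)[of v] \<kappa>(1) Av by (intro add_mono diff_left_mono divide_right_mono) auto
    also have "\<dots> = (q * norm v)\<^sup>2"
      by (simp add: power_mult_distrib q(3) algebra_simps)
    finally show ?thesis using q(1) by (intro power2_le_imp_le[of "norm (c v)"]) auto
  qed
  define C where "C = Blinfun c"
  have C_app [simp]: "C v = c v" for v
    unfolding C_def by (simp add: bounded_linear_Blinfun_apply[OF c_lin])
  have C_norm: "norm C \<le> q" using c_norm q(1) by (intro norm_blinfun_bound) auto
  have C_sym: "C u \<bullet> v = u \<bullet> C v" for u v
    using A by (simp add: c_def inner_diff sym_inner sym_pos_def_def)
  \<comment> \<open>Self-adjointness is a closed condition, so it is built into the complete set on
    which the contraction acts and the fixed point inherits it.\<close>
  define s where "s = {X :: (real ^ 'n) \<Rightarrow>\<^sub>L (real ^ 'n). norm X \<le> q \<and> (\<forall>u v. blinfun_apply X u \<bullet> v = u \<bullet> blinfun_apply X v)}"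
  define f where "f X = (1 / 2) *\<^sub>R (C + (X o\<^sub>L X))" for X :: "(real ^ 'n) \<Rightarrow>\<^sub>L (real ^ 'n)"
  have "closed s" unfolding s_def
    by (intro closed_Collect_conj closed_Collect_le closed_Collect_all closed_Collect_eq continuous_intros)
  then have "\<exists>!X\<in>s. f X = X"
  proof (rule Banach_fix[OF complete_eq_closed[THEN iffD2] _ q(1,2)])
    show "s \<noteq> {}" using q(1) by (auto simp: s_def intro!: exI[of _ 0])
    show "f ` s \<subseteq> s"
    proof safe
      fix X assume X: "X \<in> s"
      then have nX: "norm X \<le> q" and sX: "\<And>u v. blinfun_apply X u \<bullet> v = u \<bullet> blinfun_apply X v" by (auto simp: s_def)
      have "norm (X o\<^sub>L X) \<le> norm X * norm X" by (rule norm_blinfun_compose)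
      also have "\<dots> \<le> q * 1" using nX q by (intro mult_mono) auto
      finally have "norm (C + (X o\<^sub>L X)) \<le> q + q"
        using C_norm norm_triangle_ineq[of C "X o\<^sub>L X"] by simp
      moreover have "blinfun_apply (f X) u \<bullet> v = u \<bullet> blinfun_apply (f X) v" for u v
        using C_sym[of u v] by (simp add: f_def blinfun.add_left blinfun.scaleR_left inner_add sX)
      ultimately show "f X \<in> s" by (simp add: s_def f_def)
    qed
    fix X Y assume XY: "X \<in> s" "Y \<in> s"
    \<comment> \<open>\<open>X\<close> and \<open>Y\<close> need not commute, hence this form of
      \<open>X\<^sup>2 - Y\<^sup>2\<close>.\<close>
    have "f X - f Y = (1 / 2) *\<^sub>R ((X o\<^sub>L (X - Y)) + ((X - Y) o\<^sub>L Y))"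
      by (rule blinfun_eqI) (simp add: f_def blinfun.bilinear_simps algebra_simps)
    then have "dist (f X) (f Y) \<le> (1 / 2) * (norm (X o\<^sub>L (X - Y)) + norm ((X - Y) o\<^sub>L Y))"
      by (simp add: dist_norm norm_triangle_ineq)
    also have "\<dots> \<le> (1 / 2) * (norm X * norm (X - Y) + norm (X - Y) * norm Y)"
      by (intro mult_left_mono add_mono norm_blinfun_compose) auto
    also have "\<dots> \<le> (1 / 2) * (q * norm (X - Y) + norm (X - Y) * q)"
      using XY by (intro mult_left_mono add_mono mult_right_mono) (auto simp: s_def)
    finally show "dist (f X) (f Y) \<le> q * dist X Y" by (simp add: dist_norm)
  qed
  then obtain X where X: "norm X \<le> q" "\<And>u v. blinfun_apply X u \<bullet> v = u \<bullet> blinfun_apply X v" "f X = X"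
    by (auto simp: s_def)
  have XX: "X (X v) = X v + X v - c v" for v
  proof -
    have "blinfun_apply (f X) v + blinfun_apply (f X) v = c v + X (X v)"
      by (simp add: f_def blinfun.add_left blinfun.scaleR_left flip: scaleR_left_distrib)
    then show ?thesis by (simp add: X(3))
  qed
  \<comment> \<open>The fixed point satisfies \<open>X\<^sup>2 = 2 * X - C\<close>, so
    \<open>(I - X)\<^sup>2 = I - C = A / \<kappa>\<close>; the factor \<open>sqrt \<kappa>\<close>
    undoes the scaling.\<close>
  define S where "S = matrix (\<lambda>v. sqrt \<kappa> *\<^sub>R (v - X v))"
  have S: "S *v v = sqrt \<kappa> *\<^sub>R (v - X v)" for v
  proof -
    have "linear (\<lambda>v. sqrt \<kappa> *\<^sub>R (v - X v))"
      by (auto intro!: linearI simp: blinfun.bilinear_simps algebra_simps)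
    from matrix_vector_mul(2)[OF this] show ?thesis unfolding S_def by (rule fun_cong)
  qed
  have "transpose S = S"
  proof -
    have "transpose S *v u = S *v u" for u
    proof -
      have "(transpose S *v u) \<bullet> z = (S *v u) \<bullet> z" for z
        by (simp only: transpose_matrix_vector dot_lmul_matrix)
          (simp add: S inner_diff_left inner_diff_right X(2))
      then show ?thesis using vector_eq_rdot by blast
    qed
    then show ?thesis by (simp add: matrix_eq)
  qed
  moreover have "0 < v \<bullet> (S *v v)" if "v \<noteq> 0" for v
  proof -
    have "v \<bullet> X v \<le> norm v * (norm X * norm v)"
      by (intro order_trans[OF norm_cauchy_schwarz] mult_left_mono norm_blinfun) simp
    also have "\<dots> \<le> norm v * (q * norm v)"
      using X(1) by (intro mult_left_mono mult_right_mono) auto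
    also have "\<dots> < norm v * norm v" using that q by (simp add: mult_less_cancel_right2)
    finally show ?thesis
      using \<kappa>(1) by (simp add: S inner_diff_right dot_square_norm power2_eq_square)
  qed
  moreover have "S ** S = A"
  proof -
    have "(S ** S) *v v = A *v v" for v
    proof -
      have "(S ** S) *v v = \<kappa> *\<^sub>R (v - X v - (X v - X (X v)))"
        using \<kappa>(1) by (simp add: S blinfun.diff_right blinfun.scaleR_right flip: matrix_vector_mul_assoc scaleR_diff_right)
      also have "\<dots> = A *v v" using \<kappa>(1) by (simp add: XX c_def)
      finally show ?thesis .
    qed
    then show ?thesis by (simp add: matrix_eq)
  qed
  ultimately show ?thesis unfolding sym_pos_def_def by blast
qed

lemma matrix_sqrt:
  assumes "sym_pos_def F"
  shows "sym_pos_def (matrix_sqrt F)" "matrix_sqrt F ** matrix_sqrt F = F"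
proof -
  have "\<exists>!S. sym_pos_def S \<and> S ** S = F"
    using sym_pos_def_sqrt_exists[OF assms] sym_pos_def_sqrt_unique by blast
  from theI'[OF this] show "sym_pos_def (matrix_sqrt F)" "matrix_sqrt F ** matrix_sqrt F = F"
    by (auto simp: matrix_sqrt_def)
qed

subsection \<open>Convergence in distribution, uniformly over projections\<close>

text \<open>Convergence holds simultaneously on a finite net of \<open>K\<close>. Replacing
  \<open>k n\<close> by a nearby net point costs at most the integral of \<open>\<phi> j\<close>,
  which is itself a test function, so its integral under \<open>\<mu> n\<close> approaches the small
  one under \<open>\<nu>\<close>.\<close>

lemma converges_in_distribution_uniform:
  fixes f :: "'k::metric_space \<Rightarrow> 'b::real_normed_vector \<Rightarrow> real"
  assumes \<mu>: "\<And>n. prob_space (\<mu> n)" "\<And>n. sets (\<mu> n) = sets borel"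
    and \<nu>: "prob_space \<nu>" "sets \<nu> = sets borel"
    and conv: "converges_in_distribution \<mu> \<nu>"
    and K: "compact K" "\<And>n. k n \<in> K"
    and bound: "\<And>x u. x \<in> K \<Longrightarrow> \<bar>f x u\<bar> \<le> 1"
    and cont: "\<And>x. x \<in> K \<Longrightarrow> continuous_on UNIV (f x)"
    and lip: "\<And>x y u. x \<in> K \<Longrightarrow> y \<in> K \<Longrightarrow> \<bar>f x u - f y u\<bar> \<le> C * dist x y * norm u"
    and L: "\<And>x. x \<in> K \<Longrightarrow> (\<integral>u. f x u \<partial>\<nu>) = L"
  shows "(\<lambda>n. \<integral>u. f (k n) u \<partial>\<mu> n) \<longlonglongrightarrow> L"
proof -
  \<comment> \<open>The sign of \<open>C\<close> is not prescribed; a nonnegative constant makes the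
    bound monotone in the distance.\<close>
  define C' where "C' = max C 0"
  \<comment> \<open>The bound on the change of \<open>f\<close> over distances below
    \<open>1 / Suc j\<close>. The truncation at 2, permitted by
    \<open>\<bar>f x u\<bar> \<le> 1\<close>, makes it bounded.\<close>
  define \<phi> where "\<phi> j u = min 2 (C' * (1 / Suc j) * norm u)" for j and u :: 'b
  have \<phi>0: "0 \<le> \<phi> j u" "\<bar>\<phi> j u\<bar> \<le> 2" for j u
    by (auto simp: \<phi>_def C'_def)
  have \<phi>_cont: "continuous_on UNIV (\<phi> j)" for j unfolding \<phi>_def by (intro continuous_intros)
  have meas: "g \<in> borel_measurable M" if "continuous_on UNIV g" "sets M = sets borel" for g :: "'b \<Rightarrow> real" and M
    using borel_measurable_continuous_onI[OF that(1)] that(2) by (simp cong: measurable_cong_sets)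
  have int: "integrable M g"
    if "prob_space M" "continuous_on UNIV g" "sets M = sets borel" "\<And>u. \<bar>g u\<bar> \<le> B" for g :: "'b \<Rightarrow> real" and M B
  proof -
    interpret prob_space M by fact
    show ?thesis using that by (intro integrable_const_bound[where B = B] meas) auto
  qed
  have \<phi>_lim: "(\<lambda>j. \<integral>u. \<phi> j u \<partial>\<nu>) \<longlonglongrightarrow> 0"
  proof -
    interpret \<nu>: prob_space \<nu> by fact
    have "(\<lambda>j. \<integral>u. \<phi> j u \<partial>\<nu>) \<longlonglongrightarrow> (\<integral>u. 0 \<partial>\<nu>)"
    proof (rule integral_dominated_convergence[where w = "\<lambda>_. 2"])
      show "AE u in \<nu>. (\<lambda>j. \<phi> j u) \<longlonglongrightarrow> 0"
      proof (rule AE_I2)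
        fix u :: 'b
        have "(\<lambda>j. min 2 (C' * (1 / Suc j) * norm u)) \<longlonglongrightarrow> min 2 (C' * 0 * norm u)"
          by (intro tendsto_intros LIMSEQ_inverse_real_of_nat[unfolded inverse_eq_divide])
        then show "(\<lambda>j. \<phi> j u) \<longlonglongrightarrow> 0" by (simp add: \<phi>_def)
      qed
    qed (use \<phi>0 \<phi>_cont \<nu>(2) in \<open>auto intro: meas\<close>)
    then show ?thesis by simp
  qed
  show ?thesis
  proof (rule tendstoI)
    fix e :: real assume "0 < e"
    then have e3: "0 < e / 3" by simp
    obtain j where j: "(\<integral>u. \<phi> j u \<partial>\<nu>) < e / 3"
      using order_tendstoD(2)[OF \<phi>_lim e3] by (auto simp: eventually_sequentially)
    define \<delta> where "\<delta> = 1 / real (Suc j)"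
    have "0 < \<delta>" by (simp add: \<delta>_def)
    then have cover: "K \<subseteq> (\<Union>x\<in>K. ball x \<delta>)" by auto
    obtain N where N: "N \<subseteq> K" "finite N" "K \<subseteq> (\<Union>x\<in>N. ball x \<delta>)"
      by (rule compactE_image[OF K(1) open_ball cover])
    have "\<forall>x\<in>N. \<forall>\<^sub>F n in sequentially. dist (\<integral>u. f x u \<partial>\<mu> n) L < e / 3"
    proof
      fix x assume "x \<in> N"
      then have "x \<in> K" using N by auto
      have "bounded (range (f x))" using bound[OF \<open>x \<in> K\<close>] by (auto simp: bounded_iff)
      then have "(\<lambda>n. \<integral>u. f x u \<partial>\<mu> n) \<longlonglongrightarrow> (\<integral>u. f x u \<partial>\<nu>)"
        using conv cont[OF \<open>x \<in> K\<close>] unfolding converges_in_distribution_def by blast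
      then show "\<forall>\<^sub>F n in sequentially. dist (\<integral>u. f x u \<partial>\<mu> n) L < e / 3"
        unfolding L[OF \<open>x \<in> K\<close>] using e3 by (rule tendstoD)
    qed
    then have ev1: "\<forall>\<^sub>F n in sequentially. \<forall>x\<in>N. dist (\<integral>u. f x u \<partial>\<mu> n) L < e / 3"
      using N(2) by (simp add: eventually_ball_finite_distrib)
    have "bounded (range (\<phi> j))" using \<phi>0(2) by (auto simp: bounded_iff)
    then have "(\<lambda>n. \<integral>u. \<phi> j u \<partial>\<mu> n) \<longlonglongrightarrow> (\<integral>u. \<phi> j u \<partial>\<nu>)"
      using conv \<phi>_cont unfolding converges_in_distribution_def by blast
    then have ev2: "\<forall>\<^sub>F n in sequentially. (\<integral>u. \<phi> j u \<partial>\<mu> n) < e / 3" using j by (rule order_tendstoD)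
    show "\<forall>\<^sub>F n in sequentially. dist (\<integral>u. f (k n) u \<partial>\<mu> n) L < e"
      using ev1 ev2
    proof eventually_elim
      fix n assume n: "\<forall>x\<in>N. dist (\<integral>u. f x u \<partial>\<mu> n) L < e / 3" "(\<integral>u. \<phi> j u \<partial>\<mu> n) < e / 3"
      obtain x where x: "x \<in> N" "dist x (k n) < \<delta>" using N(3) K(2)[of n] by auto
      then have xK: "x \<in> K" using N by auto
      have "\<bar>f (k n) u - f x u\<bar> \<le> \<phi> j u" for u
      proof -
        have "\<bar>f (k n) u - f x u\<bar> \<le> C * dist (k n) x * norm u" by (rule lip[OF K(2) xK])
        also have "\<dots> \<le> C' * \<delta> * norm u"
          using x(2) by (intro mult_right_mono mult_mono) (auto simp: C'_def dist_commute)
        finally show ?thesis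
          using bound[OF K(2)[of n], of u] bound[OF xK, of u] by (auto simp: \<phi>_def \<delta>_def)
      qed
      then have d: "f (k n) u - f x u \<le> \<phi> j u" "f x u - f (k n) u \<le> \<phi> j u" for u
        by (simp_all add: abs_le_iff)
      note i = int[OF \<mu>(1)[of n] cont[OF K(2)[of n]] \<mu>(2) bound[OF K(2)[of n]]]
        int[OF \<mu>(1)[of n] cont[OF xK] \<mu>(2) bound[OF xK]]
        int[OF \<mu>(1)[of n] \<phi>_cont \<mu>(2) \<phi>0(2), of j]
      have "(\<integral>u. f (k n) u \<partial>\<mu> n) - (\<integral>u. f x u \<partial>\<mu> n) \<le> (\<integral>u. \<phi> j u \<partial>\<mu> n)"
        "(\<integral>u. f x u \<partial>\<mu> n) - (\<integral>u. f (k n) u \<partial>\<mu> n) \<le> (\<integral>u. \<phi> j u \<partial>\<mu> n)"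
        using i d by (simp_all flip: Bochner_Integration.integral_diff add: integral_mono)
      moreover have "\<bar>(\<integral>u. f x u \<partial>\<mu> n) - L\<bar> < e / 3" using n(1) x(1) by (simp add: dist_real_def)
      ultimately show "dist (\<integral>u. f (k n) u \<partial>\<mu> n) L < e"
        using n(2) unfolding dist_real_def by linarith
    qed
  qed
qed

text \<open>The conditions are polynomial equations in the entries, and the squared Frobenius norm
  is \<open>trace (P ** P) = trace P = r\<close>.\<close>

lemma compact_orth_proj: "compact {P :: real ^ 'p ^ 'p. orth_proj r P}"
proof -
  have "closed {P :: real ^ 'p ^ 'p. orth_proj r P}"
  proof -
    have "orth_proj r P \<longleftrightarrow> (\<forall>i j. P $ j $ i = P $ i $ j) \<and>
        (\<forall>i j. (\<Sum>k\<in>UNIV. P $ i $ k * P $ k $ j) = P $ i $ j) \<and> (\<Sum>i\<in>UNIV. P $ i $ i) = r"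
      for P :: "real ^ 'p ^ 'p"
      by (simp add: orth_proj_def transpose_def matrix_matrix_mult_def trace_def vec_eq_iff)
    then show ?thesis
      by (simp only:) (intro closed_Collect_conj closed_Collect_all closed_Collect_eq
          continuous_on_sum continuous_on_mult continuous_on_const continuous_on_component continuous_on_id)
  qed
  moreover have "bounded {P :: real ^ 'p ^ 'p. orth_proj r P}"
  proof -
    have "norm P \<le> sqrt r" if "orth_proj r P" for P :: "real ^ 'p ^ 'p"
    proof -
      have sym: "P $ i $ k = P $ k $ i" for i k
      proof -
        have "transpose P = P" using that by (simp add: orth_proj_def)
        then have "transpose P $ i $ k = P $ i $ k" by simp
        then show ?thesis by (simp add: transpose_def)
      qed
      have "(norm (P $ i))\<^sup>2 = (P ** P) $ i $ i" for i
      proof -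
        have "(P ** P) $ i $ i = (\<Sum>k\<in>UNIV. P $ i $ k * P $ k $ i)"
          by (simp add: matrix_matrix_mult_def)
        also have "\<dots> = (\<Sum>k\<in>UNIV. P $ i $ k * P $ i $ k)"
          by (intro sum.cong refl) (metis sym)
        finally show ?thesis by (simp add: power2_norm_eq_inner inner_vec_def)
      qed
      moreover have "(norm P)\<^sup>2 = (\<Sum>i\<in>UNIV. (norm (P $ i))\<^sup>2)"
        by (simp add: norm_vec_def[of P] L2_set_def sum_nonneg)
      ultimately have "(norm P)\<^sup>2 = trace P"
        using that by (simp add: trace_def orth_proj_def)
      then show ?thesis using that by (simp add: orth_proj_def real_le_rsqrt)
    qed
    then show ?thesis by (auto simp: bounded_iff)
  qed
  ultimately show ?thesis by (simp add: compact_eq_bounded_closed)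
qed

section \<open>The support function as a function of projection and point\<close>

definition proj_support :: "real \<Rightarrow> real ^ 'p ^ 'p \<Rightarrow> real ^ 'p \<Rightarrow> real" where
  "proj_support a P u = cone_support a (norm (P *v u)) (norm (u - P *v u))"

lemma proj_support_continuous: "continuous_on UNIV (proj_support a P)"
  unfolding proj_support_def cone_support_def
  by (intro continuous_intros linear_continuous_on) simp_all

lemma proj_support_measurable [measurable]: "proj_support a P \<in> borel_measurable borel"
  by (rule borel_measurable_continuous_onI[OF proj_support_continuous])

lemma proj_support_scale:
  "0 \<le> a \<Longrightarrow> a \<le> 1 \<Longrightarrow> 0 \<le> k \<Longrightarrow> proj_support a P (k *\<^sub>R u) = k * proj_support a P u"
  using cone_support_scale[OF _ _ refl, of a k "norm (P *v u)" "norm (u - P *v u)"]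
  by (simp add: proj_support_def matrix_vector_mult_scaleR flip: scaleR_diff_right)

lemma proj_support_diff_le:
  assumes a: "0 \<le> a" "a \<le> 1"
  shows "\<bar>proj_support a P u - proj_support a P' u\<bar> \<le> 2 * dist P P' * norm u"
proof -
  have "\<bar>proj_support a P u - proj_support a P' u\<bar> \<le>
      \<bar>norm (P *v u) - norm (P' *v u)\<bar> + \<bar>norm (u - P *v u) - norm (u - P' *v u)\<bar>"
    unfolding proj_support_def by (rule cone_support_diff_le[OF a refl])
  also have "\<dots> \<le> norm (P *v u - P' *v u) + norm ((u - P *v u) - (u - P' *v u))"
    by (intro add_mono norm_triangle_ineq3)
  also have "\<dots> = 2 * norm ((P - P') *v u)"
    by (simp add: matrix_vector_mult_diff_rdistrib norm_minus_commute)
  also have "\<dots> \<le> 2 * (norm (P - P') * norm u)"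
    using norm_matrix_vector_mult_le[of "P - P'" u] by simp
  finally show ?thesis by (simp add: dist_norm)
qed

text \<open>For \<open>r < p\<close> the formula of \<open>nn_integral_std_normal_proj\<close> is
  the same for both projections; for \<open>r = p\<close> both are the identity.\<close>

lemma distr_proj_support_unique:
  fixes P P' :: "real ^ 'p ^ 'p"
  assumes P: "orth_proj (real r) P" "orth_proj (real r) P'" and r: "0 < r" "r \<le> CARD('p)"
  shows "distr std_normal_vec borel (proj_support a P) = distr std_normal_vec borel (proj_support a P')"
proof (cases "r = CARD('p)")
  case True
  then have "proj_support a P = proj_support a P'"
    using P by (simp add: proj_support_def fun_eq_iff orth_proj_full)
  then show ?thesis by simp
next
  case False
  then have r': "r < CARD('p)" using r by simp
  show ?thesis
  proof (rule measure_eqI)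
    fix A assume "A \<in> sets (distr (std_normal_vec :: (real ^ 'p) measure) borel (proj_support a P))"
    then have [measurable]: "A \<in> sets borel" by simp
    define f :: "real \<Rightarrow> real \<Rightarrow> ennreal" where "f x y = indicator A (cone_support a (sqrt x) (sqrt y))" for x y
    have fm: "case_prod f \<in> borel_measurable (borel \<Otimes>\<^sub>M borel)" unfolding f_def by measurable
    have "emeasure (distr std_normal_vec borel (proj_support a Q)) A =
        (\<integral>\<^sup>+w. ennreal (chi_square_density CARD('p) w) *
          (\<integral>\<^sup>+b. f (w * b) (w * (1 - b)) * ennreal (beta_density (r / 2) (real (CARD('p) - r) / 2) b) \<partial>lborel) \<partial>lborel)"
      if Q: "orth_proj (real r) Q" for Q :: "real ^ 'p ^ 'p"
    proof -
      have "emeasure (distr std_normal_vec borel (proj_support a Q)) A =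
          (\<integral>\<^sup>+u. indicator A u \<partial>distr std_normal_vec borel (proj_support a Q))" by simp
      also have "\<dots> = (\<integral>\<^sup>+u. indicator A (proj_support a Q u) \<partial>std_normal_vec)"
        by (rule nn_integral_distr) auto
      also have "\<dots> = (\<integral>\<^sup>+u. f ((norm (Q *v u))\<^sup>2) ((norm (u - Q *v u))\<^sup>2) \<partial>std_normal_vec)"
        by (simp add: f_def proj_support_def)
      finally show ?thesis
        unfolding nn_integral_std_normal_proj[OF Q r(1) r' fm] .
    qed
    then show "emeasure (distr std_normal_vec borel (proj_support a P)) A =
        emeasure (distr std_normal_vec borel (proj_support a P')) A"
      using P by simp
  qed simp
qed

text \<open>By homogeneity each ray from the origin meets the level set of a positive value at most
  once, so the set is Lebesgue null and hence null for the normal law.\<close>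

lemma proj_support_level_null:
  fixes P :: "real ^ 'p ^ 'p"
  assumes a: "0 \<le> a" "a \<le> 1" and c: "0 < c"
  shows "measure std_normal_vec {u. proj_support a P u = c} = 0"
proof -
  let ?S = "{u. proj_support a P u = c}"
  have "closed ?S" by (intro closed_Collect_eq proj_support_continuous continuous_intros)
  then have "negligible ?S"
    by (rule starlike_negligible[where a = 0]) (use c in \<open>auto simp: proj_support_scale[OF a]\<close>)
  moreover have S: "?S \<in> sets borel" using \<open>closed ?S\<close> by (rule borel_closed)
  ultimately have "emeasure lborel ?S = 0"
    by (simp add: negligible_iff_null_sets null_sets_completion_iff null_sets_def)
  then have "AE u in lborel. \<not> proj_support a P u = c"
    using S by (subst AE_iff_measurable[of ?S]) auto
  then have "AE u in std_normal_vec. \<not> proj_support a P u = c"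
    unfolding std_normal_vec_def by (subst AE_density) (auto elim: eventually_mono)
  then have "emeasure std_normal_vec ?S = 0"
    using S by (subst (asm) AE_iff_measurable[of ?S]) auto
  then show ?thesis by (simp add: measure_def)
qed

text \<open>\<open>cts_step\<close> is an affine function of slope \<open>- 1 / (y - x)\<close>
  clamped to \<open>[0, 1]\<close>, and clamping does not increase distances.\<close>

lemma abs_cts_step_diff_le: "x < y \<Longrightarrow> \<bar>cts_step x y s - cts_step x y t\<bar> \<le> \<bar>s - t\<bar> / (y - x)"
proof -
  assume xy: "x < y"
  have "cts_step x y s = min 1 (max 0 ((y - s) / (y - x)))" for s
    using xy by (auto simp: cts_step_def min_def max_def field_simps)
  moreover have "\<bar>min 1 (max 0 u) - min 1 (max 0 v)\<bar> \<le> \<bar>u - v\<bar>" for u v :: real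
    by (auto simp: min_def max_def)
  ultimately have "\<bar>cts_step x y s - cts_step x y t\<bar> \<le> \<bar>(y - s) / (y - x) - (y - t) / (y - x)\<bar>"
    by metis
  also have "\<dots> = \<bar>s - t\<bar> / (y - x)"
    using xy by (simp add: diff_divide_distrib[symmetric] abs_divide abs_minus_commute)
  finally show ?thesis .
qed

text \<open>Weak convergence on the line can be tested on \<open>cts_step\<close>; being Lipschitz,
  these functions fit \<open>converges_in_distribution_uniform\<close>. The null level set makes
  \<open>c\<close> a continuity point of the limit.\<close>

lemma proj_support_prob_tendsto:
  fixes \<mu> :: "nat \<Rightarrow> (real ^ 'p) measure"
  assumes \<mu>: "\<And>n. prob_space (\<mu> n)" "\<And>n. sets (\<mu> n) = sets borel"
    and conv: "converges_in_distribution \<mu> std_normal_vec"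
    and P: "\<And>n. orth_proj (real r) (P n)" and r: "0 < r" "r \<le> CARD('p)"
    and a: "0 \<le> a" "a \<le> 1" and c: "0 < c"
  shows "(\<lambda>n. measure (\<mu> n) {u. proj_support a (P n) u \<le> c}) \<longlonglongrightarrow> G_cdf CARD('p) r a (c\<^sup>2)"
proof -
  define R where "R n = distr (\<mu> n) borel (proj_support a (P n))" for n
  \<comment> \<open>\<open>P 0\<close> is an arbitrary representative, as the law is the same for
    every projection of rank \<open>r\<close>.\<close>
  define R0 where "R0 = distr std_normal_vec borel (proj_support a (P 0))"
  interpret N: prob_space "std_normal_vec :: (real ^ 'p) measure" by (rule prob_space_std_normal_vec)
  have m: "proj_support a Q \<in> borel_measurable (\<mu> n)" for Q n
    using proj_support_measurable[of a Q] \<mu>(2)[of n] by (simp cong: measurable_cong_sets)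
  have R: "real_distribution (R n)" for n
    unfolding R_def real_distribution_def real_distribution_axioms_def
    using prob_space.prob_space_distr[OF \<mu>(1) m] by simp
  have R0: "real_distribution R0"
    unfolding R0_def real_distribution_def real_distribution_axioms_def
    by (auto intro!: N.prob_space_distr)
  interpret R0: real_distribution R0 by fact
  have "weak_conv_m R R0"
  proof (rule integral_cts_step_conv_imp_weak_conv[OF R R0])
    fix x y :: real assume xy: "x < y"
    have [measurable]: "cts_step x y \<in> borel_measurable borel"
      by (intro borel_measurable_continuous_onI uniformly_continuous_imp_continuous cts_step_uniformly_continuous xy)
    have "(\<lambda>n. \<integral>u. cts_step x y (proj_support a (P n) u) \<partial>\<mu> n) \<longlonglongrightarrow> (\<integral>t. cts_step x y t \<partial>R0)"
    proof (rule converges_in_distribution_uniform[OF \<mu> N.prob_space_axioms _ conv compact_orth_proj[of "real r"],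
          where f = "\<lambda>Q u. cts_step x y (proj_support a Q u)" and k = P and C = "2 / (y - x)"])
      show "\<bar>cts_step x y (proj_support a Q u)\<bar> \<le> 1" for Q and u :: "real ^ 'p"
        using xy by (auto simp: cts_step_def field_simps)
      show "continuous_on UNIV (\<lambda>u. cts_step x y (proj_support a Q u))" for Q :: "real ^ 'p ^ 'p"
        by (intro continuous_on_compose2[OF uniformly_continuous_imp_continuous[OF cts_step_uniformly_continuous[OF xy]] proj_support_continuous]) auto
      show "\<bar>cts_step x y (proj_support a Q u) - cts_step x y (proj_support a Q' u)\<bar> \<le> 2 / (y - x) * dist Q Q' * norm u" for Q Q' and u :: "real ^ 'p"
      proof -
        have "\<bar>cts_step x y (proj_support a Q u) - cts_step x y (proj_support a Q' u)\<bar> \<le>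
            \<bar>proj_support a Q u - proj_support a Q' u\<bar> / (y - x)"
          by (rule abs_cts_step_diff_le[OF xy])
        also have "\<dots> \<le> 2 * dist Q Q' * norm u / (y - x)"
          using xy by (intro divide_right_mono proj_support_diff_le a) auto
        finally show ?thesis by simp
      qed
      show "(\<integral>u. cts_step x y (proj_support a Q u) \<partial>std_normal_vec) = (\<integral>t. cts_step x y t \<partial>R0)"
        if "Q \<in> {P. orth_proj (real r) P}" for Q :: "real ^ 'p ^ 'p"
        using that P[of 0] r unfolding R0_def
        by (subst distr_proj_support_unique[of r "P 0" Q]) (auto simp: integral_distr)
    qed (use P in auto)
    then show "(\<lambda>n. \<integral>t. cts_step x y t \<partial>R n) \<longlonglongrightarrow> (\<integral>t. cts_step x y t \<partial>R0)"
      using m by (simp add: R_def integral_distr)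
  qed
  moreover have "isCont (cdf R0) c"
    unfolding R0.isCont_cdf using proj_support_level_null[OF a c, of "P 0"]
    by (simp add: R0_def measure_distr vimage_def)
  ultimately have "(\<lambda>n. cdf (R n) c) \<longlonglongrightarrow> cdf R0 c"
    by (simp add: weak_conv_m_def weak_conv_def)
  moreover have "cdf (R n) c = measure (\<mu> n) {u. proj_support a (P n) u \<le> c}" for n
    using m[of "P n" n] sets_eq_imp_space_eq[OF \<mu>(2)[of n]] by (simp add: R_def cdf_def measure_distr vimage_def)
  moreover have "cdf R0 c = G_cdf CARD('p) r a (c\<^sup>2)"
    using measure_cone_support_eq_G_cdf[OF P r a c, of 0]
    by (simp add: R0_def cdf_def measure_distr vimage_def proj_support_def[symmetric])
  ultimately show ?thesis by simp
qed

subsection \<open>The confidence bands\<close>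

text \<open>\<open>columns Z\<close> is a set, in which repeated columns would be invisible;
  injectivity lets a relation between indices be read as one between elements of that set.\<close>

lemma independent_columns_kernel:
  fixes Z :: "real ^ 'r ^ 'p"
  assumes inj: "inj (\<lambda>j. column j Z)" and indep: "independent (columns Z)" and v: "Z *v v = 0"
  shows "v = 0"
proof -
  have cols: "columns Z = range (\<lambda>j. column j Z)" by (auto simp: columns_def)
  define u where "u = (\<lambda>x. v $ inv (\<lambda>j. column j Z) x)"
  have "(\<Sum>x\<in>columns Z. u x *\<^sub>R x) = (\<Sum>j\<in>UNIV. v $ j *\<^sub>R column j Z)"
    unfolding cols by (subst sum.reindex[OF inj]) (simp add: u_def inv_f_f[OF inj])
  also have "\<dots> = 0"
    using v by (simp add: matrix_mult_sum scalar_mult_eq_scaleR)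
  finally have "(\<Sum>x\<in>columns Z. u x *\<^sub>R x) = 0" .
  then have "u (column j Z) = 0" for j
    using independentD[OF indep _ order_refl] by (auto simp: cols)
  then show ?thesis by (simp add: u_def inv_f_f[OF inj] vec_eq_iff)
qed

text \<open>With \<open>B = F\<^sup>-\<^sup>1\<^sup>/\<^sup>2 Z\<close> this is
  \<open>B (B' B)\<^sup>-\<^sup>1 B'\<close>, the orthogonal projection onto the column space of
  \<open>B\<close>.\<close>

definition region_projection :: "real ^ 'p ^ 'p \<Rightarrow> real ^ 'r ^ 'p \<Rightarrow> real ^ 'p ^ 'p" where
  "region_projection F Z =
     matrix_inv (matrix_sqrt F) ** Z ** matrix_inv (transpose Z ** matrix_inv F ** Z) **
     transpose Z ** matrix_inv (matrix_sqrt F)"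

context
  fixes F :: "real ^ 'p ^ 'p"
  assumes F: "sym_pos_def F"
begin

lemma matrix_sqrt_inv:
  "matrix_sqrt F ** matrix_inv (matrix_sqrt F) = mat 1"
  "matrix_inv (matrix_sqrt F) ** matrix_sqrt F = mat 1"
  "transpose (matrix_inv (matrix_sqrt F)) = matrix_inv (matrix_sqrt F)"
  "matrix_inv (matrix_sqrt F) ** matrix_inv (matrix_sqrt F) = matrix_inv F"
proof -
  note S = matrix_sqrt[OF F]
  show 1: "matrix_sqrt F ** matrix_inv (matrix_sqrt F) = mat 1"
    and 2: "matrix_inv (matrix_sqrt F) ** matrix_sqrt F = mat 1"
    and "transpose (matrix_inv (matrix_sqrt F)) = matrix_inv (matrix_sqrt F)"
    by (rule sym_pos_def_invertible[OF S(1)] sym_pos_def_transpose_inv[OF S(1)])+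
  let ?S = "matrix_sqrt F" and ?Si = "matrix_inv (matrix_sqrt F)"
  have "F ** (?Si ** ?Si) = ?S ** (?S ** ?Si) ** ?Si"
    by (subst S(2)[symmetric]) (simp only: matrix_mul_assoc)
  then have "F ** (?Si ** ?Si) = mat 1" by (simp add: 1)
  then show "?Si ** ?Si = matrix_inv F"
    by (metis matrix_mul_assoc matrix_mul_lid matrix_mul_rid sym_pos_def_invertible(2)[OF F])
qed

text \<open>\<open>N\<close> is the Gram matrix of \<open>Si ** Z\<close>, whose kernel is trivial,
  so it is positive definite and invertible. Cyclicity reduces the trace to that of the identity of
  size \<open>r\<close>.\<close>

lemma orth_proj_region_projection:
  fixes Z :: "real ^ 'r ^ 'p"
  assumes Z: "inj (\<lambda>j. column j Z)" "independent (columns Z)"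
  shows "orth_proj CARD('r) (region_projection F Z)"
proof -
  define Si where "Si = matrix_inv (matrix_sqrt F)"
  note Si = matrix_sqrt_inv[folded Si_def]
  define N where "N = transpose Z ** matrix_inv F ** Z"
  have N: "N = transpose Z ** Si ** Si ** Z" by (simp add: N_def Si(4)[symmetric] matrix_mul_assoc)
  have "sym_pos_def N"
    unfolding sym_pos_def_def
  proof safe
    show "transpose N = N" by (simp add: N matrix_transpose_mul Si(3) matrix_mul_assoc)
    fix v :: "real ^ 'r" assume "v \<noteq> 0"
    then have "Z *v v \<noteq> 0" using independent_columns_kernel[OF Z] by blast
    then have ne: "Si *v (Z *v v) \<noteq> 0"
      by (metis Si(1) matrix_vector_mul_assoc matrix_vector_mul_lid matrix_vector_mult_0_right)
    have "v \<bullet> (N *v v) = (Si *v (Z *v v)) \<bullet> (Si *v (Z *v v))"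
      using sym_inner[OF Si(3)]
      by (simp add: N flip: matrix_vector_mul_assoc)
        (metis dot_lmul_matrix vector_transpose_matrix transpose_transpose inner_commute)
    then show "0 < v \<bullet> (N *v v)" using ne by simp
  qed
  define W where "W = matrix_inv N"
  have W: "N ** W = mat 1" "W ** N = mat 1" "transpose W = W"
    unfolding W_def using sym_pos_def_invertible[OF \<open>sym_pos_def N\<close>] sym_pos_def_transpose_inv[OF \<open>sym_pos_def N\<close>] by auto
  have P: "region_projection F Z = Si ** Z ** W ** transpose Z ** Si"
    by (simp add: region_projection_def Si_def W_def N_def)
  show ?thesis
    unfolding orth_proj_def
  proof (intro conjI)
    show "transpose (region_projection F Z) = region_projection F Z"
      by (simp add: P matrix_transpose_mul Si(3) W(3) matrix_mul_assoc)
    have "region_projection F Z ** region_projection F Z = Si ** Z ** (W ** N) ** W ** transpose Z ** Si"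
      by (simp add: P N matrix_mul_assoc)
    then show "region_projection F Z ** region_projection F Z = region_projection F Z"
      by (simp add: P W(2))
    have "trace (region_projection F Z) = trace ((W ** transpose Z ** Si) ** (Si ** Z))"
      using trace_mul_sym[of "Si ** Z" "W ** transpose Z ** Si"] by (simp add: P matrix_mul_assoc)
    also have "(W ** transpose Z ** Si) ** (Si ** Z) = W ** N" by (simp add: N matrix_mul_assoc)
    finally show "trace (region_projection F Z) = CARD('r)" by (simp add: W(2) trace_I)
  qed
qed

text \<open>In the coordinate \<open>y = F\<^sup>-\<^sup>1\<^sup>/\<^sup>2 x\<close> the two
  quadratic forms become the squared norms of \<open>P y\<close> and \<open>y\<close>;
  \<open>0 \<le> a\<close> permits taking roots.\<close>

lemma predictor_region_iff:
  fixes Z :: "real ^ 'r ^ 'p"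
  assumes Z: "inj (\<lambda>j. column j Z)" "independent (columns Z)" and a: "0 \<le> a"
  defines "y \<equiv> \<lambda>x. matrix_inv (matrix_sqrt F) *v x"
  shows "x \<in> predictor_region F Z a \<longleftrightarrow> a * norm (y x) \<le> norm (region_projection F Z *v y x)"
    and "sqrt (x \<bullet> (matrix_inv F *v x)) = norm (y x)"
proof -
  define Si where "Si = matrix_inv (matrix_sqrt F)"
  note Si = matrix_sqrt_inv[folded Si_def]
  define P where "P = region_projection F Z"
  have P: "orth_proj CARD('r) P" unfolding P_def by (rule orth_proj_region_projection[OF Z])
  have q: "x \<bullet> (matrix_inv F *v x) = (norm (y x))\<^sup>2"
    using sym_inner[OF Si(3), of x "Si *v x"]
    by (simp add: y_def Si_def[symmetric] Si(4)[symmetric] power2_norm_eq_inner flip: matrix_vector_mul_assoc)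
  then show "sqrt (x \<bullet> (matrix_inv F *v x)) = norm (y x)" by simp
  have "matrix_inv F ** Z ** matrix_inv (transpose Z ** matrix_inv F ** Z) ** transpose Z ** matrix_inv F =
      Si ** P ** Si"
    by (simp add: P_def region_projection_def Si_def[symmetric] Si(4)[symmetric] matrix_mul_assoc)
  then have "x \<bullet> ((matrix_inv F ** Z ** matrix_inv (transpose Z ** matrix_inv F ** Z) ** transpose Z ** matrix_inv F) *v x) =
      x \<bullet> (Si *v (P *v y x))"
    by (simp add: y_def Si_def[symmetric] flip: matrix_vector_mul_assoc)
  also have "\<dots> = y x \<bullet> (P *v (P *v y x))"
    using sym_inner[OF Si(3), of x "P *v y x"] by (simp add: y_def Si_def[symmetric] orth_proj_idem[OF P])
  also have "\<dots> = (norm (P *v y x))\<^sup>2"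
    using orth_proj_inner[OF P, of "y x" "P *v y x"] by (simp add: power2_norm_eq_inner orth_proj_idem[OF P])
  finally have "x \<in> predictor_region F Z a \<longleftrightarrow> (a * norm (y x))\<^sup>2 \<le> (norm (P *v y x))\<^sup>2"
    by (simp add: predictor_region_def q power_mult_distrib)
  also have "\<dots> \<longleftrightarrow> a * norm (y x) \<le> norm (P *v y x)"
    using a by (simp add: abs_le_square_iff[symmetric])
  finally show "x \<in> predictor_region F Z a \<longleftrightarrow> a * norm (y x) \<le> norm (region_projection F Z *v y x)"
    by (simp add: P_def)
qed

text \<open>\<open>x \<bullet> (b - \<beta>)\<close> equals the inner product of
  \<open>F\<^sup>-\<^sup>1\<^sup>/\<^sup>2 x\<close> with
  \<open>F\<^sup>1\<^sup>/\<^sup>2 (b - \<beta>)\<close>. Since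
  \<open>x \<mapsto> F\<^sup>-\<^sup>1\<^sup>/\<^sup>2 x\<close> is a bijection,
  \<open>cone_band_iff\<close> applies.\<close>

lemma band_iff_proj_support:
  fixes Z :: "real ^ 'r ^ 'p"
  assumes Z: "inj (\<lambda>j. column j Z)" "independent (columns Z)"
    and a: "0 \<le> a" "a \<le> 1" and c: "0 \<le> c"
  shows "(\<forall>x \<in> predictor_region F Z a.
      x \<bullet> b - c * sqrt (x \<bullet> (matrix_inv F *v x)) \<le> x \<bullet> \<beta> \<and>
      x \<bullet> \<beta> \<le> x \<bullet> b + c * sqrt (x \<bullet> (matrix_inv F *v x))) \<longleftrightarrow>
    proj_support a (region_projection F Z) (matrix_sqrt F *v (b - \<beta>)) \<le> c"
proof -
  let ?S = "matrix_sqrt F" and ?Si = "matrix_inv (matrix_sqrt F)" and ?P = "region_projection F Z"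
  have S: "transpose ?S = ?S" using matrix_sqrt(1)[OF F] by (simp add: sym_pos_def_def)
  have cancel: "?S *v (?Si *v x) = x" "?Si *v (?S *v x) = x" for x
    by (simp_all add: matrix_vector_mul_assoc matrix_sqrt_inv)
  have shift: "x \<bullet> (b - \<beta>) = (?Si *v x) \<bullet> (?S *v (b - \<beta>))" for x
    using sym_inner[OF S, of "?Si *v x" "b - \<beta>"] by (simp add: cancel)
  have step: "(x \<bullet> b - c * sqrt (x \<bullet> (matrix_inv F *v x)) \<le> x \<bullet> \<beta> \<and>
      x \<bullet> \<beta> \<le> x \<bullet> b + c * sqrt (x \<bullet> (matrix_inv F *v x))) \<longleftrightarrow>
      \<bar>(?Si *v x) \<bullet> (?S *v (b - \<beta>))\<bar> \<le> c * norm (?Si *v x)" for x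
    unfolding predictor_region_iff(2)[OF Z a(1)] shift[symmetric] inner_diff_right by auto
  have "(\<forall>x \<in> predictor_region F Z a. \<bar>(?Si *v x) \<bullet> (?S *v (b - \<beta>))\<bar> \<le> c * norm (?Si *v x)) \<longleftrightarrow>
      (\<forall>y. a * norm y \<le> norm (?P *v y) \<longrightarrow> \<bar>y \<bullet> (?S *v (b - \<beta>))\<bar> \<le> c * norm y)"
    unfolding Ball_def predictor_region_iff(1)[OF Z a(1)] using cancel by metis
  also have "\<dots> \<longleftrightarrow> proj_support a ?P (?S *v (b - \<beta>)) \<le> c"
    unfolding proj_support_def
    by (rule cone_band_iff[OF orth_proj_region_projection[OF Z] _ a c]) simp
  finally show ?thesis by (simp only: step)
qed

end

text \<open>The logistic function is strictly increasing, so at each \<open>x\<close> both bands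
  express the same condition.\<close>

lemma resp_prob_band_iff:
  "1 / (1 + exp (- (x \<bullet> b) + e)) \<le> resp_prob \<beta> x \<and> resp_prob \<beta> x \<le> 1 / (1 + exp (- (x \<bullet> b) - e)) \<longleftrightarrow>
    x \<bullet> b - e \<le> x \<bullet> \<beta> \<and> x \<bullet> \<beta> \<le> x \<bullet> b + e"
proof -
  have "1 / (1 + exp (- s)) \<le> 1 / (1 + exp (- t)) \<longleftrightarrow> s \<le> t" for s t :: real
  proof -
    have "0 < 1 + exp (- s)" "0 < 1 + exp (- t)" by (simp_all add: add_pos_pos)
    then show ?thesis by (simp add: divide_simps)
  qed
  from this[of "x \<bullet> b - e" "x \<bullet> \<beta>"] this[of "x \<bullet> \<beta>" "x \<bullet> b + e"] show ?thesis
    by (simp add: resp_prob_def)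
qed

theorem theorem1:
  fixes Z :: "real ^ 'r::finite ^ 'p::finite"
    and a \<alpha> c :: real
    and \<beta> :: "real ^ 'p"
    and M :: "nat \<Rightarrow> 'w measure"
    and d :: "nat \<Rightarrow> nat \<Rightarrow> real ^ 'p"
    and Y :: "nat \<Rightarrow> nat \<Rightarrow> 'w \<Rightarrow> nat"
    and bh :: "nat \<Rightarrow> 'w \<Rightarrow> real ^ 'p"
    and F :: "nat \<Rightarrow> real ^ 'p ^ 'p"
    and Q :: "'g measure"
    and G :: "'g \<Rightarrow> real"
  assumes "CARD('r) \<le> CARD('p)"
    and "inj (\<lambda>j. column j Z)" and "independent (columns Z)"
    and "0 \<le> a" and "a \<le> 1"
    and "0 < \<alpha>" and "\<alpha> < 1"
    and "\<And>n. logistic_sample (M n) \<beta> n (d n) (Y n)"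
    and "\<And>n. ml_estimator (M n) n (d n) (Y n) (bh n)"
    and "\<And>n. F n = fisher_information (M n) \<beta> n (d n) (Y n)"
    and "\<forall>\<^sub>F n in sequentially. sym_pos_def (F n)"
    and "converges_in_distribution
           (\<lambda>n. distr (M n) borel (\<lambda>\<omega>. matrix_sqrt (F n) *v (bh n \<omega> - \<beta>))) std_normal_vec"
    and "prob_space Q" and "G \<in> borel_measurable Q"
    and "\<And>\<omega>. \<omega> \<in> space Q \<Longrightarrow> 0 \<le> G \<omega>"
    and "\<And>g. 0 < g \<Longrightarrow>
           measure Q {\<omega> \<in> space Q. G \<omega> \<le> g} = G_cdf CARD('p) CARD('r) a g"
    and "0 < c"
    and "measure Q {\<omega> \<in> space Q. G \<omega> \<le> c\<^sup>2} = 1 - \<alpha>"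
  shows "(\<lambda>n. measure (M n) {\<omega> \<in> space (M n). \<forall>x \<in> predictor_region (F n) Z a.
             x \<bullet> bh n \<omega> - c * sqrt (x \<bullet> (matrix_inv (F n) *v x)) \<le> x \<bullet> \<beta> \<and>
             x \<bullet> \<beta> \<le> x \<bullet> bh n \<omega> + c * sqrt (x \<bullet> (matrix_inv (F n) *v x))})
           \<longlonglongrightarrow> 1 - \<alpha> \<and>
         (\<lambda>n. measure (M n) {\<omega> \<in> space (M n). \<forall>x \<in> predictor_region (F n) Z a.
             1 / (1 + exp (- (x \<bullet> bh n \<omega>) + c * sqrt (x \<bullet> (matrix_inv (F n) *v x))))
               \<le> resp_prob \<beta> x \<and>
             resp_prob \<beta> x
               \<le> 1 / (1 + exp (- (x \<bullet> bh n \<omega>) - c * sqrt (x \<bullet> (matrix_inv (F n) *v x))))})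
           \<longlonglongrightarrow> 1 - \<alpha>"
proof -
  note Z = assms(2,3) and a = assms(4,5) and pd = assms(11) and conv = assms(12) and c = assms(17)
  define u where "u n \<omega> = matrix_sqrt (F n) *v (bh n \<omega> - \<beta>)" for n \<omega>
  define \<mu> where "\<mu> n = distr (M n) borel (u n)" for n
  obtain n0 where n0: "sym_pos_def (F n0)" using pd by (auto simp: eventually_sequentially)
  \<comment> \<open>\<open>F n\<close> is positive definite only from some \<open>n\<close> on;
    before that, \<open>F n0\<close> stands in so that every \<open>P n\<close> is a projection of
    rank \<open>r\<close>. Finitely many terms do not affect the limit.\<close>
  define P where "P n = region_projection (if sym_pos_def (F n) then F n else F n0) Z" for n
  have P: "orth_proj (real CARD('r)) (P n)" for n
    unfolding P_def using n0 by (auto intro: orth_proj_region_projection[OF _ Z])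
  have u [measurable]: "u n \<in> borel_measurable (M n)" for n
  proof -
    have [measurable]: "bh n \<in> borel_measurable (M n)" using assms(9)[of n] by (simp add: ml_estimator_def)
    have [measurable]: "(*v) (matrix_sqrt (F n)) \<in> borel_measurable borel"
      by (intro borel_measurable_continuous_onI linear_continuous_on) simp
    show ?thesis unfolding u_def by measurable
  qed
  have "prob_space (M n)" for n using assms(8)[of n] by (simp add: logistic_sample_def)
  then have "prob_space (\<mu> n)" for n unfolding \<mu>_def by (rule prob_space.prob_space_distr) (rule u)
  then have "(\<lambda>n. measure (\<mu> n) {v. proj_support a (P n) v \<le> c}) \<longlonglongrightarrow> G_cdf CARD('p) CARD('r) a (c\<^sup>2)"
    using conv assms(1) P a c
    by (intro proj_support_prob_tendsto) (auto simp: \<mu>_def u_def[abs_def])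
  moreover have "G_cdf CARD('p) CARD('r) a (c\<^sup>2) = 1 - \<alpha>"
    using assms(16)[of "c\<^sup>2"] assms(18) c by simp
  moreover have "measure (\<mu> n) {v. proj_support a (P n) v \<le> c} =
      measure (M n) {\<omega> \<in> space (M n). proj_support a (P n) (u n \<omega>) \<le> c}" for n
    unfolding \<mu>_def by (subst measure_distr) (auto intro!: arg_cong[of _ _ "measure (M n)"])
  ultimately have lim: "(\<lambda>n. measure (M n) {\<omega> \<in> space (M n). proj_support a (P n) (u n \<omega>) \<le> c}) \<longlonglongrightarrow> 1 - \<alpha>"
    by simp
  have "\<forall>\<^sub>F n in sequentially.
      measure (M n) {\<omega> \<in> space (M n). proj_support a (P n) (u n \<omega>) \<le> c} =
      measure (M n) {\<omega> \<in> space (M n). \<forall>x \<in> predictor_region (F n) Z a.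
             x \<bullet> bh n \<omega> - c * sqrt (x \<bullet> (matrix_inv (F n) *v x)) \<le> x \<bullet> \<beta> \<and>
             x \<bullet> \<beta> \<le> x \<bullet> bh n \<omega> + c * sqrt (x \<bullet> (matrix_inv (F n) *v x))}"
    using pd
  proof eventually_elim
    case (elim n)
    then show ?case
      using c by (simp only: band_iff_proj_support[OF elim Z a] less_imp_le) (simp add: P_def u_def)
  qed
  \<comment> \<open>The band for the response probability is the same event, so the same limit
    proves both claims.\<close>
  from Lim_transform_eventually[OF lim this] show ?thesis
    unfolding resp_prob_band_iff by simp
qed

end
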